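(* Let $\underline\lambda=(\lambda^{(1)},\dots,\lambda^{(r)})$ be an $r$-partition with $n$ boxes, with content function $c$ determined by $q^{2c(b)}=u_kq^{2(y-x)}$ for the box $b$ in position $(x,y)$ (row $x$, column $y$) of the $k$-th component $\lambda^{(k)}$. The change-of-basis for the cyclotomic Hecke algebra module $\mathbb{H}_{r,n}^{\underline\lambda}$ expressing the natural basis $\{n_T\mid T\in\mathrm{SYT}(\underline\lambda)\}$ in terms of the seminormal basis $\{v_T\mid T\in\mathrm{SYT}(\underline\lambda)\}$ satisfies $$n_T=\sum_{S\le T}\tilde A_{S,T}\,v_S,\qquad\text{with coefficients}\qquad\tilde A_{S,T}=\sum_{\omega\subseteq\pi}\widetilde{\mathrm{wt}}_\pi(\omega),$$ where the first sum is over standard $r$-tableaux $S\in\mathrm{SYT}(\underline\lambda)$ with $S\le T$ in Bruhat order; the coefficient $\tilde A_{S,T}$ is defined using any path $\pi$ from the column reading tableau $C$ to $T$ in the weak Bruhat graph $\mathcal{B}_n^{\underline\lambda}$; the second sum is over all subpaths $\omega\subseteq\pi$ which terminate at $S$; and $\widetilde{\mathrm{wt}}_\pi(\omega)$ is the weight of the subpath $\omega\subseteq\pi$ defined from the coefficients $\tilde a_i$ given in the context.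
   Context: Tableaux. An $r$-partition of $n$ is an ordered $r$-tuple $\underline\lambda=(\lambda^{(1)},\dots,\lambda^{(r)})$ of (possibly empty) partitions with $|\lambda^{(1)}|+\cdots+|\lambda^{(r)}|=n$. An $r$-tableau of shape $\underline\lambda$ is a filling of its boxes by $1,\dots,n$, each used once; it is standard if in each component the entries increase left to right in rows and top to bottom in columns. $\mathrm{SYT}(\underline\lambda)$ is the set of standard $r$-tableaux. $\sigma\in\mathbb{S}_n$ acts by replacing each entry $k$ by $\sigma(k)$; $s_i=(i,i+1)$. The column reading tableau $C$ is the standard $r$-tableau obtained by entering $1,\dots,n$ consecutively down the columns, beginning with the leftmost component and filling in the columns from left to right. $w_T\in\mathbb{S}_n$ is the unique permutation with $w_T(C)=T$. Bruhat order: $S\le T$ iff $w_S\le w_T$ in strong Bruhat order on $\mathbb{S}_n$. The weak Bruhat graph $\mathcal{B}_n^{\underline\lambda}$ is the undirected graph on $\mathrm{SYT}(\underline\lambda)$ with an edge labeled $s_i$ between $S$ and $T$ whenever $T=s_i(S)$. Algebra. Let $u_1,\dots,u_r,q\in\mathbb{C}^\ast$ with $q$ not a root of unity. The cyclotomic Hecke algebra $\mathbb{H}_{r,n}=\mathbb{H}_{r,n}(u_1,\dots,u_r;q)$ is the associative unital $\mathbb{C}$-algebra generated by $T_0,\dots,T_{n-1}$ with relations $T_iT_j=T_jT_i$ ($|i-j|>1$); $T_iT_{i+1}T_i=T_{i+1}T_iT_{i+1}$ ($1\le i\le n-2$); $T_0T_1T_0T_1=T_1T_0T_1T_0$; $T_i^2=(q-q^{-1})T_i+1$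 ($1\le i\le n-1$); $(T_0-u_1)\cdots(T_0-u_r)=0$. The parameters are assumed chosen so that $\mathbb{H}_{r,n}$ is semisimple; this requires that $u_iu_j^{-1}\notin\{1,q^2,\dots,q^{2n}\}$ for $i\ne j$ and $[n]_q!\ne0$, where $[n]_q!=[n]_q[n-1]_q\cdots[1]_q$ and $[k]_q=(q^k-q^{-k})/(q-q^{-1})$. For $w\in\mathbb{S}_n$ with reduced word $w=s_{i_1}\cdots s_{i_k}$, $T_w=T_{i_1}\cdots T_{i_k}$ (independent of the reduced word). Module. For $T\in\mathrm{SYT}(\underline\lambda)$ let $T(i)$ be the box of $T$ containing $i$; suppose $i$ lies in row $x_i$ (counted downward), column $y_i$ of component $\lambda^{(k_i)}$, and put $ct(T(i))=y_i-x_i$. For $1\le i\le n-1$ let $$\tilde a_i(T)=\frac{q-q^{-1}}{1-q^{2(c(T(i))-c(T(i+1)))}}=\frac{q-q^{-1}}{1-\frac{u_{k_i}}{u_{k_{i+1}}}q^{2(ct(T(i))-ct(T(i+1)))}}.$$ The irreducible module $\mathbb{H}_{r,n}^{\underline\lambda}$ has $\mathbb{C}$-basis $\{v_T\mid T\in\mathrm{SYT}(\underline\lambda)\}$ (the seminormal basis) with action $$T_0v_T=u_kv_T\ \text{ if }1\text{ is in the }k\text{-th component of }T,\qquad T_iv_T=\tilde a_i(T)v_T+(q^{-1}+\tilde a_i(T))v_{s_i(T)}\ (1\le i\le n-1),$$ where $v_{s_i(T)}=0$ if $s_i(T)$ is nonstandard. The natural basis is $\{n_T\mid T\in\mathrm{SYT}(\underline\lambda)\}$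 with $n_T:=T_{w_T}v_C$. Paths. A path in $\mathcal{B}_n^{\underline\lambda}$ from $T_0$ to $T_k$ is a sequence $\pi=(T_0\xrightarrow{s_{i_1}}T_1\xrightarrow{s_{i_2}}\cdots\xrightarrow{s_{i_k}}T_k)$ ($k\ge0$) of standard $r$-tableaux with $T_j=s_{i_j}(T_{j-1})$. A subpath $\omega\subseteq\pi$ is a sequence $\omega=(T_0=S_0\xrightarrow{z_1}S_1\xrightarrow{z_2}\cdots\xrightarrow{z_k}S_k)$ of standard $r$-tableaux with $z_j\in\{s_{i_j},e\}$ ($e$ the identity) and $S_j=z_j(S_{j-1})$; it terminates at $S_k$. Its weight is $\widetilde{\mathrm{wt}}_\pi(\omega)=\prod_{j=1}^k\tilde b_j$, where $\tilde b_j=\tilde a_{i_j}(S_{j-1})$ if $z_j=e$ and $\tilde b_j=\tilde a_{i_j}(S_{j-1})+q^{-1}$ if $z_j=s_{i_j}$; the empty path has weight $1$.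
   Formalization: "Any path π from C to T" is restricted to reduced paths (labels spell a reduced word of w_T), which are shown to exist; for arbitrary paths it fails: for λ=(2,1), the path C→s_2C→C gives v_C coefficient 1+(q−q⁻¹)ã_2(C)≠1, though n_C=v_C. *)

theory Defs
  imports
    Complex_Main
    "HOL-Algebra.QuotRing"
    "HOL-Combinatorics.Permutations"
    "HOL-Library.Poly_Mapping"
begin

section \<open>Multipartitions and standard tableaux\<close>

definition is_partition :: "nat list \<Rightarrow> bool" where
  "is_partition p \<longleftrightarrow> sorted_wrt (\<ge>) p \<and> 0 \<notin> set p"

text \<open>An \<open>r\<close>-partition is a list of length \<open>r\<close> of (possibly empty) partitions.\<close>

definition multipartition :: "nat \<Rightarrow> nat \<Rightarrow> nat list list \<Rightarrow> bool" where
  "multipartition r n lam \<longleftrightarrow>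
     length lam = r \<and> (\<forall>p\<in>set lam. is_partition p) \<and> sum_list (map sum_list lam) = n"

text \<open>
  A box is a triple (component, row, column). All three coordinates are counted from 0; the
  content \<open>column - row\<close> does not depend on this. Accordingly the parameters
  \<open>u\<^sub>1, \<dots>, u\<^sub>r\<close> are given as a list \<open>us\<close>, and
  \<open>us ! k\<close> belongs to the component with index \<open>k\<close>.
\<close>

type_synonym box = "nat \<times> nat \<times> nat"

text \<open>
  A tableau maps each box to its entry. Outside the diagram it has the value 0, so that a
  tableau is determined by its entries and a permutation of \<open>{1..n}\<close>, which fixes 0,
  acts on tableaux simply by composition.
\<close>

type_synonym tableau = "box \<Rightarrow> nat"

definition boxes :: "nat list list \<Rightarrow> box set" where
  "boxes lam = {(k, x, y). k < length lam \<and> x < length (lam ! k) \<and> y < lam ! k ! x}"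

definition is_tableau :: "nat \<Rightarrow> nat list list \<Rightarrow> tableau \<Rightarrow> bool" where
  "is_tableau n lam T \<longleftrightarrow> bij_betw T (boxes lam) {1..n} \<and> (\<forall>b. b \<notin> boxes lam \<longrightarrow> T b = 0)"

definition standard :: "nat list list \<Rightarrow> tableau \<Rightarrow> bool" where
  "standard lam T \<longleftrightarrow>
     (\<forall>k x y y'. (k, x, y) \<in> boxes lam \<and> (k, x, y') \<in> boxes lam \<and> y < y'
        \<longrightarrow> T (k, x, y) < T (k, x, y')) \<and>
     (\<forall>k x x' y. (k, x, y) \<in> boxes lam \<and> (k, x', y) \<in> boxes lam \<and> x < x'
        \<longrightarrow> T (k, x, y) < T (k, x', y))"

definition SYT :: "nat \<Rightarrow> nat list list \<Rightarrow> tableau set" where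
  "SYT n lam = {T. is_tableau n lam T \<and> standard lam T}"

definition box_of :: "nat list list \<Rightarrow> tableau \<Rightarrow> nat \<Rightarrow> box" where
  "box_of lam T i = (THE b. b \<in> boxes lam \<and> T b = i)"

text \<open>
  In the column reading tableau the entry of a box is its position in the order in which the
  boxes are filled: by component, then by column, then downwards within the column.
\<close>

fun column_reading_le :: "box \<Rightarrow> box \<Rightarrow> bool" where
  "column_reading_le (k, x, y) (k', x', y') \<longleftrightarrow>
     k < k' \<or> (k = k' \<and> (y < y' \<or> (y = y' \<and> x \<le> x')))"

definition column_reading :: "nat list list \<Rightarrow> tableau" where
  "column_reading lam b =
     (if b \<in> boxes lam then card {b' \<in> boxes lam. column_reading_le b' b} else 0)"

definition tableau_perm :: "nat \<Rightarrow> nat list list \<Rightarrow> tableau \<Rightarrow> (nat \<Rightarrow> nat)" where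
  "tableau_perm n lam T = (THE w. w permutes {1..n} \<and> w \<circ> column_reading lam = T)"


section \<open>Reduced words and strong Bruhat order\<close>

definition simple :: "nat \<Rightarrow> nat \<Rightarrow> nat" where
  "simple i = transpose i (Suc i)"

fun perm_of_word :: "nat list \<Rightarrow> (nat \<Rightarrow> nat)" where
  "perm_of_word [] = id"
| "perm_of_word (i # is) = simple i \<circ> perm_of_word is"

definition coxeter_length :: "nat \<Rightarrow> (nat \<Rightarrow> nat) \<Rightarrow> nat" where
  "coxeter_length n w =
     (LEAST k. \<exists>is. set is \<subseteq> {1..<n} \<and> perm_of_word is = w \<and> length is = k)"

definition reduced_word :: "nat \<Rightarrow> (nat \<Rightarrow> nat) \<Rightarrow> nat list \<Rightarrow> bool" where
  "reduced_word n w is \<longleftrightarrow>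
     set is \<subseteq> {1..<n} \<and> perm_of_word is = w \<and> length is = coxeter_length n w"

definition bruhat_step :: "nat \<Rightarrow> (nat \<Rightarrow> nat) \<Rightarrow> (nat \<Rightarrow> nat) \<Rightarrow> bool" where
  "bruhat_step n u w \<longleftrightarrow>
     (\<exists>a\<in>{1..n}. \<exists>b\<in>{1..n}. a \<noteq> b \<and> w = transpose a b \<circ> u) \<and>
     coxeter_length n u < coxeter_length n w"

definition bruhat_le :: "nat \<Rightarrow> (nat \<Rightarrow> nat) \<Rightarrow> (nat \<Rightarrow> nat) \<Rightarrow> bool" where
  "bruhat_le n = (bruhat_step n)\<^sup>*\<^sup>*"

definition tableau_le :: "nat \<Rightarrow> nat list list \<Rightarrow> tableau \<Rightarrow> tableau \<Rightarrow> bool" where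
  "tableau_le n lam S T \<longleftrightarrow> bruhat_le n (tableau_perm n lam S) (tableau_perm n lam T)"


section \<open>The cyclotomic Hecke algebra\<close>

text \<open>
  The free monoid on a type of letters is the type of lists, written additively here because
  the convolution product on \<^typ>\<open>'a \<Rightarrow>\<^sub>0 'b\<close> is defined for an additive monoid \<open>'a\<close>.
  The free algebra on the letters \<open>0, \<dots>, n - 1\<close> is then the monoid algebra of words
  in these letters.
\<close>

instantiation list :: (type) monoid_add
begin

definition zero_list :: "'a list" where "zero_list = []"
definition plus_list :: "'a list \<Rightarrow> 'a list \<Rightarrow> 'a list" where "plus_list xs ys = xs @ ys"

instance by standard (simp_all add: zero_list_def plus_list_def)

end

type_synonym free_elem = "nat list \<Rightarrow>\<^sub>0 complex"

definition free_const :: "complex \<Rightarrow> free_elem" where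
  "free_const c = Poly_Mapping.single [] c"

definition free_gen :: "nat \<Rightarrow> free_elem" where
  "free_gen i = Poly_Mapping.single [i] 1"

definition free_algebra :: "nat \<Rightarrow> free_elem ring" where
  "free_algebra n =
     \<lparr>carrier = {f. \<forall>w\<in>Poly_Mapping.keys f. set w \<subseteq> {..<n}},
      monoid.mult = (*), one = 1, ring.zero = 0, add = (+)\<rparr>"

definition hecke_relators :: "nat \<Rightarrow> complex list \<Rightarrow> complex \<Rightarrow> free_elem set" where
  "hecke_relators n us q =
     {free_gen i * free_gen j - free_gen j * free_gen i |i j.
        i < n \<and> j < n \<and> (i + 1 < j \<or> j + 1 < i)} \<union>
     {free_gen i * free_gen (i+1) * free_gen i - free_gen (i+1) * free_gen i * free_gen (i+1) |i.
        1 \<le> i \<and> i + 1 < n} \<union>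
     (if 2 \<le> n
      then {free_gen 0 * free_gen 1 * free_gen 0 * free_gen 1
            - free_gen 1 * free_gen 0 * free_gen 1 * free_gen 0} else {}) \<union>
     {free_gen i * free_gen i - (free_const (q - inverse q) * free_gen i + 1) |i.
        1 \<le> i \<and> i < n} \<union>
     (if 1 \<le> n then {prod_list (map (\<lambda>u. free_gen 0 - free_const u) us)} else {})"

definition hecke_ideal :: "nat \<Rightarrow> complex list \<Rightarrow> complex \<Rightarrow> free_elem set" where
  "hecke_ideal n us q = genideal (free_algebra n) (hecke_relators n us q)"

definition hecke_algebra :: "nat \<Rightarrow> complex list \<Rightarrow> complex \<Rightarrow> free_elem set ring" where
  "hecke_algebra n us q = free_algebra n Quot hecke_ideal n us q"

definition hecke_class :: "nat \<Rightarrow> complex list \<Rightarrow> complex \<Rightarrow> free_elem \<Rightarrow> free_elem set" where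
  "hecke_class n us q f = a_r_coset (free_algebra n) (hecke_ideal n us q) f"

definition hecke_const :: "nat \<Rightarrow> complex list \<Rightarrow> complex \<Rightarrow> complex \<Rightarrow> free_elem set" where
  "hecke_const n us q c = hecke_class n us q (free_const c)"

definition hecke_gen :: "nat \<Rightarrow> complex list \<Rightarrow> complex \<Rightarrow> nat \<Rightarrow> free_elem set" where
  "hecke_gen n us q i = hecke_class n us q (free_gen i)"

definition hecke_word :: "nat \<Rightarrow> complex list \<Rightarrow> complex \<Rightarrow> nat list \<Rightarrow> free_elem set" where
  "hecke_word n us q is =
     foldr (\<lambda>i h. hecke_gen n us q i \<otimes>\<^bsub>hecke_algebra n us q\<^esub> h) is \<one>\<^bsub>hecke_algebra n us q\<^esub>"

text \<open>\<open>T\<^sub>w\<close>; by the braid relations the choice of the reduced word is immaterial.\<close>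

definition hecke_T :: "nat \<Rightarrow> complex list \<Rightarrow> complex \<Rightarrow> (nat \<Rightarrow> nat) \<Rightarrow> free_elem set" where
  "hecke_T n us q w = hecke_word n us q (SOME is. reduced_word n w is)"

definition left_ideal :: "'a set \<Rightarrow> ('a, 'b) ring_scheme \<Rightarrow> bool" where
  "left_ideal L R \<longleftrightarrow>
     additive_subgroup L R \<and> (\<forall>a\<in>carrier R. \<forall>x\<in>L. a \<otimes>\<^bsub>R\<^esub> x \<in> L)"

text \<open>A ring is semisimple if its regular left module is completely reducible.\<close>

definition semisimple_ring :: "('a, 'b) ring_scheme \<Rightarrow> bool" where
  "semisimple_ring R \<longleftrightarrow>
     ring R \<and> (\<forall>L. left_ideal L R \<longrightarrow>
       (\<exists>L'. left_ideal L' R \<and> L \<inter> L' = {\<zero>\<^bsub>R\<^esub>} \<and> L <+>\<^bsub>R\<^esub> L' = carrier R))"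

definition q_int :: "complex \<Rightarrow> nat \<Rightarrow> complex" where
  "q_int q k = (q ^ k - inverse q ^ k) / (q - inverse q)"

definition q_fact :: "complex \<Rightarrow> nat \<Rightarrow> complex" where
  "q_fact q n = (\<Prod>k=1..n. q_int q k)"

definition admissible_parameters :: "nat \<Rightarrow> complex list \<Rightarrow> complex \<Rightarrow> bool" where
  "admissible_parameters n us q \<longleftrightarrow>
     (\<forall>u\<in>set us. u \<noteq> 0) \<and> q \<noteq> 0 \<and> (\<forall>m>0. q ^ m \<noteq> 1) \<and>
     semisimple_ring (hecke_algebra n us q) \<and>
     (\<forall>i<length us. \<forall>j<length us. i \<noteq> j \<longrightarrow>
        us ! i * inverse (us ! j) \<notin> {q ^ (2 * m) |m. m \<le> n}) \<and>
     q_fact q n \<noteq> 0"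


section \<open>The module, its seminormal basis and its natural basis\<close>

locale hecke_module = vector_space scale
  for scale :: "complex \<Rightarrow> 'v::ab_group_add \<Rightarrow> 'v" +
  fixes n :: nat and us :: "complex list" and q :: complex
    and act :: "free_elem set \<Rightarrow> 'v \<Rightarrow> 'v"
  assumes act_linear:
      "h \<in> carrier (hecke_algebra n us q) \<Longrightarrow> Vector_Spaces.linear scale scale (act h)"
    and act_add: "\<lbrakk>h \<in> carrier (hecke_algebra n us q); h' \<in> carrier (hecke_algebra n us q)\<rbrakk> \<Longrightarrow>
      act (h \<oplus>\<^bsub>hecke_algebra n us q\<^esub> h') v = act h v + act h' v"
    and act_mult: "\<lbrakk>h \<in> carrier (hecke_algebra n us q); h' \<in> carrier (hecke_algebra n us q)\<rbrakk> \<Longrightarrow>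
      act (h \<otimes>\<^bsub>hecke_algebra n us q\<^esub> h') v = act h (act h' v)"
    and act_const: "act (hecke_const n us q c) v = scale c v"

text \<open>
  The content function \<open>c\<close> enters only through \<open>q\<^bsup>2c(b)\<^esup>\<close>, which is
  \<open>u\<^sub>k q\<^bsup>2(y - x)\<^esup>\<close> for the box \<open>b\<close> in row \<open>x\<close> and column \<open>y\<close>
  of component \<open>k\<close>.
\<close>

fun box_content :: "box \<Rightarrow> int" where
  "box_content (k, x, y) = int y - int x"

definition a_coeff :: "nat list list \<Rightarrow> complex list \<Rightarrow> complex \<Rightarrow> nat \<Rightarrow> tableau \<Rightarrow> complex" where
  "a_coeff lam us q i T =
     (let b = box_of lam T i; b' = box_of lam T (i + 1) in
      (q - inverse q) /
      (1 - (us ! fst b / us ! fst b') * q powi (2 * (box_content b - box_content b'))))"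

definition seminormal_basis ::
  "(complex \<Rightarrow> 'v::ab_group_add \<Rightarrow> 'v) \<Rightarrow> nat \<Rightarrow> complex list \<Rightarrow> complex \<Rightarrow>
   (free_elem set \<Rightarrow> 'v \<Rightarrow> 'v) \<Rightarrow> nat list list \<Rightarrow> (tableau \<Rightarrow> 'v) \<Rightarrow> bool" where
  "seminormal_basis scale n us q act lam v \<longleftrightarrow>
     inj_on v (SYT n lam) \<and>
     \<not> module.dependent scale (v ` SYT n lam) \<and>
     module.span scale (v ` SYT n lam) = UNIV \<and>
     (1 \<le> n \<longrightarrow> (\<forall>T\<in>SYT n lam.
        act (hecke_gen n us q 0) (v T) = scale (us ! fst (box_of lam T 1)) (v T))) \<and>
     (\<forall>i\<in>{1..<n}. \<forall>T\<in>SYT n lam.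
        act (hecke_gen n us q i) (v T) =
          scale (a_coeff lam us q i T) (v T) +
          scale (inverse q + a_coeff lam us q i T)
            (if simple i \<circ> T \<in> SYT n lam then v (simple i \<circ> T) else 0))"

definition natural_basis ::
  "nat \<Rightarrow> complex list \<Rightarrow> complex \<Rightarrow> (free_elem set \<Rightarrow> 'v \<Rightarrow> 'v) \<Rightarrow>
   nat list list \<Rightarrow> (tableau \<Rightarrow> 'v) \<Rightarrow> tableau \<Rightarrow> 'v" where
  "natural_basis n us q act lam v T =
     act (hecke_T n us q (tableau_perm n lam T)) (v (column_reading lam))"


section \<open>Paths and subpaths in the weak Bruhat graph\<close>

definition weak_bruhat_edge :: "nat \<Rightarrow> nat list list \<Rightarrow> tableau \<Rightarrow> nat \<Rightarrow> tableau \<Rightarrow> bool" where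
  "weak_bruhat_edge n lam S i T \<longleftrightarrow>
     S \<in> SYT n lam \<and> T \<in> SYT n lam \<and> i \<in> {1..<n} \<and> T = simple i \<circ> S"

text \<open>
  A path of length \<open>k\<close> is the list \<open>[i\<^sub>1, \<dots>, i\<^sub>k]\<close> of its labels together with
  the list \<open>[T\<^sub>0, \<dots>, T\<^sub>k]\<close> of its vertices.
\<close>

type_synonym path = "nat list \<times> tableau list"

definition is_path :: "nat \<Rightarrow> nat list list \<Rightarrow> tableau \<Rightarrow> tableau \<Rightarrow> path \<Rightarrow> bool" where
  "is_path n lam S T \<pi> \<longleftrightarrow>
     (case \<pi> of (is, Ts) \<Rightarrow>
        length Ts = Suc (length is) \<and> set Ts \<subseteq> SYT n lam \<and> hd Ts = S \<and> last Ts = T \<and>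
        (\<forall>j<length is. weak_bruhat_edge n lam (Ts ! j) (is ! j) (Ts ! Suc j)))"

text \<open>
  A path \<open>[i\<^sub>1, \<dots>, i\<^sub>k]\<close> from the column reading tableau to \<open>T\<close> spells the
  expression \<open>s\<^bsub>i\<^sub>k\<^esub> \<dots> s\<^bsub>i\<^sub>1\<^esub>\<close> of \<open>w\<^sub>T\<close>. It has to be
  reduced for \<open>T\<^bsub>i\<^sub>k\<^esub> \<dots> T\<^bsub>i\<^sub>1\<^esub>\<close> to be \<open>T\<^bsub>w\<^sub>T\<^esub>\<close>. For
  instance, going back and forth along an edge at \<open>C\<close> labeled \<open>s\<^sub>i\<close> gives
  \<open>T\<^sub>i\<^sup>2 v\<^sub>C\<close>, which is not \<open>n\<^sub>C = v\<^sub>C\<close>.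
\<close>

definition reduced_path :: "nat \<Rightarrow> nat list list \<Rightarrow> tableau \<Rightarrow> path \<Rightarrow> bool" where
  "reduced_path n lam T \<pi> \<longleftrightarrow>
     is_path n lam (column_reading lam) T \<pi> \<and>
     reduced_word n (tableau_perm n lam T) (rev (fst \<pi>))"

text \<open>A subpath is given by the permutations \<open>[z\<^sub>1, \<dots>, z\<^sub>k]\<close> and the tableaux
  \<open>[S\<^sub>0, \<dots>, S\<^sub>k]\<close>.\<close>

type_synonym subpath = "(nat \<Rightarrow> nat) list \<times> tableau list"

definition is_subpath :: "nat \<Rightarrow> nat list list \<Rightarrow> path \<Rightarrow> subpath \<Rightarrow> bool" where
  "is_subpath n lam \<pi> \<omega> \<longleftrightarrow>
     (case \<pi> of (is, Ts) \<Rightarrow> case \<omega> of (zs, Ss) \<Rightarrow>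
        length zs = length is \<and> length Ss = Suc (length is) \<and> set Ss \<subseteq> SYT n lam \<and>
        hd Ss = hd Ts \<and>
        (\<forall>j<length is. zs ! j \<in> {simple (is ! j), id} \<and> Ss ! Suc j = zs ! j \<circ> Ss ! j))"

definition subpaths_to :: "nat \<Rightarrow> nat list list \<Rightarrow> path \<Rightarrow> tableau \<Rightarrow> subpath set" where
  "subpaths_to n lam \<pi> S = {\<omega>. is_subpath n lam \<pi> \<omega> \<and> last (snd \<omega>) = S}"

definition subpath_weight ::
  "nat list list \<Rightarrow> complex list \<Rightarrow> complex \<Rightarrow> path \<Rightarrow> subpath \<Rightarrow> complex" where
  "subpath_weight lam us q \<pi> \<omega> =
     (case \<pi> of (is, Ts) \<Rightarrow> case \<omega> of (zs, Ss) \<Rightarrow>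
        (\<Prod>j<length is.
           if zs ! j = id then a_coeff lam us q (is ! j) (Ss ! j)
           else a_coeff lam us q (is ! j) (Ss ! j) + inverse q))"

definition path_coeff ::
  "nat \<Rightarrow> nat list list \<Rightarrow> complex list \<Rightarrow> complex \<Rightarrow> path \<Rightarrow> tableau \<Rightarrow> complex" where
  "path_coeff n lam us q \<pi> S = (\<Sum>\<omega>\<in>subpaths_to n lam \<pi> S. subpath_weight lam us q \<pi> \<omega>)"

end

theory Submission
  imports Defs
begin

text \<open>
  Let \<open>C\<close> be the column reading tableau and let \<open>w\<close> be the permutation with \<open>w(C) = T\<close>.

  The vector \<open>n\<^sub>T = T\<^sub>w v\<^sub>C\<close> can be computed along any reduced word
  \<open>s\<^bsub>i\<^sub>k\<^esub> \<dots> s\<^bsub>i\<^sub>1\<^esub>\<close> of \<open>w\<close>, since the operators by which the generators act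
  satisfy the commutation and braid relations and any two reduced words of \<open>w\<close> are linked by these
  (\<open>foldr_reduced_word_eq\<close>, \<open>hecke_T_act\<close>). Applying the generators to \<open>v\<^sub>C\<close> one after
  the other, each application splits a multiple of some \<open>v\<^sub>S\<close> into a term in which \<open>S\<close>
  stays and a term in which \<open>S\<close> moves along \<open>s\<^sub>i\<close>. Multiplying out, the terms are the
  subpaths of the path with labels \<open>i\<^sub>1, \<dots>, i\<^sub>k\<close>, and the coefficients are their weights
  (\<open>foldr_seminormal_expansion\<close>). Collecting the subpaths by their endpoints gives the stated
  coefficients.

  There remain two combinatorial facts. A subpath ends at a tableau \<open>u(C)\<close>, where \<open>u\<close> is the
  product over a subword of a reduced word of \<open>w\<close>; so \<open>u \<le> w\<close> by the lifting property of the
  Bruhat order (\<open>bruhat_le_left_ascent\<close>, \<open>subpath_bruhat_le\<close>). And a reduced path exists: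
  if \<open>i\<close> is a left descent of \<open>w\<close>, then the column reading meets \<open>i + 1\<close> before
  \<open>i\<close> in \<open>T\<close>, so that these entries are not in the same row or column and
  \<open>s\<^sub>i(T)\<close> is standard again (\<open>simple_left_descent_SYT\<close>). Splitting off left descents thus
  leads from \<open>T\<close> back to \<open>C\<close> within the standard tableaux.

  Lengths enter through the number of inversions (\<open>coxeter_length_eq_inversions\<close>), which a
  transposition of two values changes in the direction given by the order of their positions
  (\<open>card_inversions_transpose\<close>), and a simple one by exactly one.
\<close>

section \<open>Inversions and Coxeter length\<close>

text \<open>If \<open>w\<close> is written in one-line notation, \<open>perm_inv w k\<close> is the position of the
  value \<open>k\<close>.\<close>

abbreviation perm_inv :: "(nat \<Rightarrow> nat) \<Rightarrow> nat \<Rightarrow> nat" where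
  "perm_inv w \<equiv> inv_into UNIV w"

definition inversions :: "(nat \<Rightarrow> nat) \<Rightarrow> (nat \<times> nat) set" where
  "inversions w = {(x, y). x < y \<and> w y < w x}"

lemma inversions_id: "inversions id = {}"
  by (auto simp: inversions_def)

lemma finite_inversions:
  assumes "w permutes {1..n}"
  shows "finite (inversions w)"
proof -
  have "y \<le> n" if "x < y" "w y < w x" for x y
  proof (rule ccontr)
    assume "\<not> y \<le> n"
    then have "w y = y" using assms by (simp add: permutes_not_in)
    with that \<open>\<not> y \<le> n\<close> have "w x \<notin> {1..n}" by auto
    then have "x \<notin> {1..n}" using permutes_in_image[OF assms] by blast
    then have "w x = x" using assms by (simp add: permutes_not_in)
    with that \<open>w y = y\<close> show False by simp
  qed
  then have "inversions w \<subseteq> {..n} \<times> {..n}"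
    unfolding inversions_def by fastforce
  then show ?thesis by (rule finite_subset) simp
qed

lemma permutes_transpose_comp:
  assumes "w permutes {1..n}" "a \<in> {1..n}" "b \<in> {1..n}"
  shows "transpose a b \<circ> w permutes {1..n}"
  using assms by (intro permutes_compose permutes_swap_id)

lemma inv_transpose_comp:
  assumes "w permutes {1..n}"
  shows "perm_inv (transpose a b \<circ> w) = perm_inv w \<circ> transpose a b"
  using permutes_bij[OF assms] by (simp add: o_inv_distrib)

text \<open>
  Writing \<open>p < p'\<close> for the positions of \<open>a < b\<close>, the composite
  \<open>transpose a b \<circ> w\<close> is \<open>w \<circ> t\<close> with \<open>t = transpose p p'\<close>. An inversion of
  \<open>w\<close> is sent to its image under \<open>t\<close> if \<open>t\<close> keeps the order of the two positions,
  and to itself otherwise. This is an injection into the inversions of \<open>w \<circ> t\<close>, because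
  whether \<open>t\<close> reverses a pair can be read off from its image; and it misses \<open>(p, p')\<close>,
  which is an inversion of \<open>w \<circ> t\<close> but not of \<open>w\<close>.
\<close>

lemma card_inversions_transpose:
  assumes w: "w permutes {1..n}" and range: "a \<in> {1..n}" "b \<in> {1..n}"
    and ab: "a < b" "perm_inv w a < perm_inv w b"
  shows "card (inversions w) < card (inversions (transpose a b \<circ> w))"
proof -
  define p p' where "p = perm_inv w a" and "p' = perm_inv w b"
  define t where "t = transpose p p'"
  have wp: "w p = a" "w p' = b"
    unfolding p_def p'_def using permutes_inverses(1)[OF w] by auto
  have pp: "p < p'" using ab unfolding p_def p'_def by simp
  have v: "transpose a b \<circ> w = w \<circ> t"
    unfolding t_def using wp permutes_inj[OF w] by (metis transpose_comp_eq permutes_bij w p_def p'_def comp_assoc)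
  have tt[simp]: "t (t x) = x" for x unfolding t_def by simp
  define \<phi> where "\<phi> = (\<lambda>(x, y). if t x < t y then (t x, t y) else (x, y))"
  have notin: "(p, p') \<notin> inversions w"
    using wp ab by (simp add: inversions_def)
  have mem: "\<phi> z \<in> inversions (w \<circ> t) - {(p, p')}" if z: "z \<in> inversions w" for z
  proof -
    obtain x y where xy: "z = (x, y)" by fastforce
    have lt: "x < y" "w y < w x" using z xy by (auto simp: inversions_def)
    show ?thesis
    proof (cases "t x < t y")
      case True
      moreover have "(t x, t y) \<noteq> (p, p')"
        using lt pp unfolding t_def transpose_def by (auto split: if_splits)
      ultimately show ?thesis using lt xy by (simp add: \<phi>_def inversions_def)
    next
      case False
      have "(x, y) \<noteq> (p, p')" using notin z xy by metis
      moreover have "w (t y) < w (t x)"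
        using False lt pp wp ab \<open>(x, y) \<noteq> (p, p')\<close>
        unfolding t_def transpose_def by (auto split: if_splits)
      ultimately show ?thesis using False lt xy by (simp add: \<phi>_def inversions_def)
    qed
  qed
  have inj: "inj_on \<phi> (inversions w)"
  proof (rule inj_onI)
    fix z z' assume "z \<in> inversions w" "z' \<in> inversions w" "\<phi> z = \<phi> z'"
    then show "z = z'"
      by (cases z; cases z'; simp add: \<phi>_def inversions_def split: if_splits; metis tt)
  qed
  have "(p, p') \<in> inversions (w \<circ> t)"
    using pp wp ab by (simp add: inversions_def t_def)
  moreover have "finite (inversions (w \<circ> t))"
    using finite_inversions[OF permutes_transpose_comp[OF w range]] v by simp
  ultimately show ?thesis
    unfolding v using card_inj_on_le[OF inj, of "inversions (w \<circ> t) - {(p, p')}"] mem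
    by (metis (no_types, lifting) card_Diff1_less finite_Diff image_subsetI le_less_trans)
qed

text \<open>
  A simple transposition reverses the order of one pair of numbers only. This explains why it changes
  the number of inversions by exactly one, why it conjugates one transposition \<open>transpose a b\<close> with
  \<open>a < b\<close> to another without reversing \<open>a\<close> and \<open>b\<close>, and why it can spoil the
  standardness of a tableau only at the entries \<open>i\<close> and \<open>i + 1\<close>.
\<close>

lemma simple_mono:
  assumes "x < y" "\<not> (x = i \<and> y = Suc i)"
  shows "simple i x < simple i y"
  using assms by (auto simp: simple_def transpose_def)

lemma inversions_simple_comp:
  assumes w: "w permutes {1..n}" and asc: "perm_inv w i < perm_inv w (Suc i)"
  shows "inversions (simple i \<circ> w) = insert (perm_inv w i, perm_inv w (Suc i)) (inversions w)"
proof (intro equalityI subsetI)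
  have pw: "w (perm_inv w z) = z" "perm_inv w (w z) = z" for z using permutes_inverses[OF w] by auto
  fix z assume "z \<in> inversions (simple i \<circ> w)"
  then obtain x y where z: "z = (x, y)" "x < y" "simple i (w y) < simple i (w x)"
    by (auto simp: inversions_def)
  have "w x \<noteq> w y" using z(2) permutes_inj[OF w] by (metis injD less_irrefl)
  then have "w y < w x \<or> (w x = i \<and> w y = Suc i)"
    using z(3) simple_mono[of "w x" "w y" i] by linarith
  then show "z \<in> insert (perm_inv w i, perm_inv w (Suc i)) (inversions w)"
    using z(1,2) pw(2)[of x] pw(2)[of y] by (auto simp: inversions_def)
next
  have pw: "w (perm_inv w z) = z" "perm_inv w (w z) = z" for z using permutes_inverses[OF w] by auto
  fix z assume z: "z \<in> insert (perm_inv w i, perm_inv w (Suc i)) (inversions w)"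
  have "simple i (w y) < simple i (w x)" if "x < y" "w y < w x" for x y
  proof (rule simple_mono[OF that(2)])
    show "\<not> (w y = i \<and> w x = Suc i)" using pw asc that(1) by (metis less_asym)
  qed
  then show "z \<in> inversions (simple i \<circ> w)"
    using z asc by (auto simp: inversions_def pw simple_def)
qed

lemma card_inversions_simple:
  assumes w: "w permutes {1..n}" and asc: "perm_inv w i < perm_inv w (Suc i)"
  shows "card (inversions (simple i \<circ> w)) = Suc (card (inversions w))"
proof -
  have "w (perm_inv w z) = z" for z using permutes_inverses[OF w] by auto
  then have "(perm_inv w i, perm_inv w (Suc i)) \<notin> inversions w"
    by (simp add: inversions_def)
  then show ?thesis
    by (simp add: inversions_simple_comp[OF assms] finite_inversions[OF w])
qed

definition left_descent :: "(nat \<Rightarrow> nat) \<Rightarrow> nat \<Rightarrow> bool" where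
  "left_descent w i \<longleftrightarrow> perm_inv w (Suc i) < perm_inv w i"

lemma simple_involutive [simp]: "simple i (simple i x) = x"
  by (simp add: simple_def)

lemma simple_comp_simple [simp]: "simple i \<circ> (simple i \<circ> w) = w"
  by (rule ext) simp

lemma permutes_simple_comp:
  assumes "w permutes {1..n}" "i \<in> {1..<n}"
  shows "simple i \<circ> w permutes {1..n}"
  unfolding simple_def using assms by (intro permutes_transpose_comp) auto

lemma inv_simple_comp:
  assumes "w permutes {1..n}"
  shows "perm_inv (simple i \<circ> w) = perm_inv w \<circ> simple i"
  unfolding simple_def by (rule inv_transpose_comp[OF assms])

lemma inv_permutes_neq:
  assumes "w permutes {1..n}"
  shows "perm_inv w i \<noteq> perm_inv w (Suc i)"
  using permutes_inverses(1)[OF assms] by (metis n_not_Suc_n)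

lemma left_descent_simple_comp:
  assumes w: "w permutes {1..n}"
  shows "left_descent (simple i \<circ> w) i \<longleftrightarrow> \<not> left_descent w i"
  using inv_permutes_neq[OF w, of i]
  unfolding left_descent_def inv_simple_comp[OF w] by (auto simp: simple_def)

lemma card_inversions_simple_cases:
  assumes w: "w permutes {1..n}" and i: "i \<in> {1..<n}"
  shows "if left_descent w i
         then card (inversions w) = Suc (card (inversions (simple i \<circ> w)))
         else card (inversions (simple i \<circ> w)) = Suc (card (inversions w))"
proof (cases "left_descent w i")
  case True
  then have "\<not> left_descent (simple i \<circ> w) i" using left_descent_simple_comp[OF w] by blast
  then have "perm_inv (simple i \<circ> w) i < perm_inv (simple i \<circ> w) (Suc i)"
    using inv_permutes_neq[OF permutes_simple_comp[OF w i], of i] by (simp add: left_descent_def)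
  from card_inversions_simple[OF permutes_simple_comp[OF w i] this] True show ?thesis by simp
next
  case False
  then have "perm_inv w i < perm_inv w (Suc i)"
    using inv_permutes_neq[OF w, of i] by (simp add: left_descent_def)
  from card_inversions_simple[OF w this] False show ?thesis by simp
qed

text \<open>
  Without a descent the inverse of \<open>w\<close> is strictly increasing on \<open>{1..n}\<close>, hence the identity.
\<close>

lemma exists_left_descent:
  assumes w: "w permutes {1..n}" and "w \<noteq> id"
  shows "\<exists>i\<in>{1..<n}. left_descent w i"
proof (rule ccontr)
  assume no: "\<not> ?thesis"
  have wi: "perm_inv w permutes {1..n}" by (rule permutes_inv[OF w])
  have step: "perm_inv w i < perm_inv w (Suc i)" if "i \<in> {1..<n}" for i
    using no that inv_permutes_neq[OF w, of i] unfolding left_descent_def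
    by (meson linorder_neqE_nat)
  have "strict_mono_on {1..n} (perm_inv w)"
  proof (rule strict_mono_onI)
    fix r s assume "r \<in> {1..n}" "s \<in> {1..n}" "r < s"
    then show "perm_inv w r < perm_inv w s"
    proof (induction s)
      case (Suc s)
      then show ?case using step[of s] by (cases "r = s") auto
    qed simp
  qed
  \<comment> \<open>A permutation of \<open>{1..n}\<close> that lies above the identity pointwise is the identity.\<close>
  have ge: "i \<le> perm_inv w i" if "i \<in> {1..n}" for i
    using that
  proof (induction i)
    case (Suc i)
    show ?case
    proof (cases "i = 0")
      case True
      then show ?thesis using permutes_in_image[OF wi, of 1] Suc.prems by auto
    next
      case False
      then show ?thesis using Suc step[of i] by auto
    qed
  qed simp
  have "perm_inv w = id"
    using permutes_natset_ge[OF wi] ge by blast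
  then have "w = id" using w by (metis inv_id permutes_inv_inv)
  with assms(2) show False by simp
qed

lemma perm_of_word_permutes:
  assumes "set ks \<subseteq> {1..<n}"
  shows "perm_of_word ks permutes {1..n}"
  using assms
proof (induction ks)
  case Nil
  show ?case by (simp add: permutes_id del: id_apply)
next
  case (Cons i ks)
  then show ?case using permutes_simple_comp[of "perm_of_word ks" n i]
    by (metis list.set_intros insert_subset list.simps(15) perm_of_word.simps(2))
qed

lemma card_inversions_le_length:
  assumes "set ks \<subseteq> {1..<n}"
  shows "card (inversions (perm_of_word ks)) \<le> length ks"
  using assms
proof (induction ks)
  case Nil
  show ?case by (simp only: perm_of_word.simps inversions_id card.empty)
next
  case (Cons i ks)
  have "perm_of_word ks permutes {1..n}" using Cons.prems by (intro perm_of_word_permutes) auto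
  from card_inversions_simple_cases[OF this, of i] Cons show ?case
    by (auto simp: comp_def split: if_splits)
qed

lemma exists_word_of_length_inversions:
  assumes "w permutes {1..n}"
  shows "\<exists>ks. set ks \<subseteq> {1..<n} \<and> perm_of_word ks = w \<and> length ks = card (inversions w)"
  using assms
proof (induction "card (inversions w)" arbitrary: w rule: less_induct)
  case less
  show ?case
  proof (cases "w = id")
    case True
    then show ?thesis using inversions_id by (metis card.empty empty_set empty_subsetI list.size(3) perm_of_word.simps(1))
  next
    case False
    then obtain i where i: "i \<in> {1..<n}" "left_descent w i"
      using exists_left_descent[OF less.prems] by blast
    have c: "card (inversions w) = Suc (card (inversions (simple i \<circ> w)))"
      using card_inversions_simple_cases[OF less.prems i(1)] i(2) by simp
    then obtain ks where "set ks \<subseteq> {1..<n}" "perm_of_word ks = simple i \<circ> w"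
      "length ks = card (inversions (simple i \<circ> w))"
      using less.hyps[of "simple i \<circ> w"] permutes_simple_comp[OF less.prems i(1)] by auto
    then show ?thesis using i(1) c by (intro exI[of _ "i # ks"]) auto
  qed
qed

text \<open>
  The factors of a word change the number of inversions by at most one each, so a word is at least as
  long as this number; removing left descents one after the other yields a word that attains it.
\<close>

lemma coxeter_length_eq_inversions:
  assumes "w permutes {1..n}"
  shows "coxeter_length n w = card (inversions w)"
  unfolding coxeter_length_def
proof (rule Least_equality)
  show "\<exists>ks. set ks \<subseteq> {1..<n} \<and> perm_of_word ks = w \<and> length ks = card (inversions w)"
    by (rule exists_word_of_length_inversions[OF assms])
next
  fix k assume "\<exists>ks. set ks \<subseteq> {1..<n} \<and> perm_of_word ks = w \<and> length ks = k"
  then show "card (inversions w) \<le> k" using card_inversions_le_length by blast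
qed

lemma exists_reduced_word:
  assumes "w permutes {1..n}"
  shows "\<exists>ks. reduced_word n w ks"
  unfolding reduced_word_def coxeter_length_eq_inversions[OF assms]
  by (rule exists_word_of_length_inversions[OF assms])

lemma coxeter_length_simple_comp:
  assumes w: "w permutes {1..n}" and i: "i \<in> {1..<n}"
  shows "left_descent w i \<Longrightarrow> coxeter_length n w = Suc (coxeter_length n (simple i \<circ> w))"
    and "\<not> left_descent w i \<Longrightarrow> coxeter_length n (simple i \<circ> w) = Suc (coxeter_length n w)"
  using card_inversions_simple_cases[OF assms]
  by (simp_all add: coxeter_length_eq_inversions[OF w]
      coxeter_length_eq_inversions[OF permutes_simple_comp[OF assms]])

lemma reduced_word_permutes: "reduced_word n w ks \<Longrightarrow> w permutes {1..n}"
  unfolding reduced_word_def using perm_of_word_permutes by blast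

text \<open>
  Together with its converse, this reduces statements on reduced words to an induction in
  which the first letter runs through the left descents of the permutation.
\<close>

lemma reduced_word_ConsD:
  assumes "reduced_word n w (i # ks)"
  shows "i \<in> {1..<n}" "left_descent w i" "reduced_word n (simple i \<circ> w) ks"
proof -
  have w: "w permutes {1..n}" by (rule reduced_word_permutes[OF assms])
  show i: "i \<in> {1..<n}" using assms by (simp add: reduced_word_def)
  have eq: "perm_of_word ks = simple i \<circ> w" and ks: "set ks \<subseteq> {1..<n}"
    using assms by (auto simp: reduced_word_def)
  have "coxeter_length n (simple i \<circ> w) \<le> length ks"
    using card_inversions_le_length[OF ks]
    by (simp add: eq coxeter_length_eq_inversions[OF permutes_simple_comp[OF w i]])
  then have le: "coxeter_length n (simple i \<circ> w) < coxeter_length n w"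
    using assms by (simp add: reduced_word_def)
  then show d: "left_descent w i"
    using coxeter_length_simple_comp(2)[OF w i] by linarith
  show "reduced_word n (simple i \<circ> w) ks"
    using eq ks assms coxeter_length_simple_comp(1)[OF w i d] by (simp add: reduced_word_def)
qed

lemma reduced_word_ConsI:
  assumes "w permutes {1..n}" "i \<in> {1..<n}" "left_descent w i" "reduced_word n (simple i \<circ> w) ks"
  shows "reduced_word n w (i # ks)"
  using assms coxeter_length_simple_comp(1)[OF assms(1-3)]
  by (auto simp: reduced_word_def)


section \<open>Independence of the reduced word\<close>

lemma simple_commute:
  assumes "i + 1 < j \<or> j + 1 < i"
  shows "simple i \<circ> simple j = simple j \<circ> simple i"
  using assms by (auto simp: simple_def transpose_def fun_eq_iff)

lemma simple_braid:
  "simple i \<circ> (simple (Suc i) \<circ> (simple i \<circ> w)) = simple (Suc i) \<circ> (simple i \<circ> (simple (Suc i) \<circ> w))"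
  by (auto simp: simple_def transpose_def fun_eq_iff)

text \<open>
  If \<open>w\<close> has the left descents \<open>i\<close> and \<open>j\<close> and \<open>s\<^sub>i\<close> commutes with
  \<open>s\<^sub>j\<close>, then \<open>w = s\<^sub>i s\<^sub>j u = s\<^sub>j s\<^sub>i u\<close> with lengths adding up. A reduced word
  \<open>ms\<close> of \<open>u\<close> links the two given words: each of them can be replaced, by induction on the
  length applied behind its first letter, by one that ends in \<open>ms\<close>, and these two differ by a
  commutation.
\<close>

lemma foldr_reduced_word_commute:
  fixes f :: "nat \<Rightarrow> 'a \<Rightarrow> 'a"
  assumes comm: "f i \<circ> f j = f j \<circ> f i" and ij: "i + 1 < j \<or> j + 1 < i"
    and red: "reduced_word n w (i # ks)" "reduced_word n w (j # ls)"
    and IH: "\<And>v ks' ls'. coxeter_length n v < coxeter_length n w \<Longrightarrow>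
      reduced_word n v ks' \<Longrightarrow> reduced_word n v ls' \<Longrightarrow> foldr f ks' x = foldr f ls' x"
  shows "foldr f (i # ks) x = foldr f (j # ls) x"
proof -
  have w: "w permutes {1..n}" by (rule reduced_word_permutes[OF red(1)])
  note I = reduced_word_ConsD[OF red(1)] and J = reduced_word_ConsD[OF red(2)]
  have wi: "simple i \<circ> w permutes {1..n}" and wj: "simple j \<circ> w permutes {1..n}"
    using permutes_simple_comp[OF w] I(1) J(1) by blast+
  have "left_descent (simple i \<circ> w) j" "left_descent (simple j \<circ> w) i"
    using I(2) J(2) ij unfolding left_descent_def inv_simple_comp[OF w]
    by (auto simp: simple_def transpose_def)
  note D = this
  define u where "u = simple j \<circ> (simple i \<circ> w)"
  have u: "u = simple i \<circ> (simple j \<circ> w)"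
    using simple_commute[OF ij] unfolding u_def by (simp add: o_assoc)
  have "u permutes {1..n}" unfolding u_def by (rule permutes_simple_comp[OF wi J(1)])
  then obtain ms where ms: "reduced_word n u ms" using exists_reduced_word by blast
  have "reduced_word n (simple i \<circ> w) (j # ms)" "reduced_word n (simple j \<circ> w) (i # ms)"
    using reduced_word_ConsI[OF wi J(1) D(1)] reduced_word_ConsI[OF wj I(1) D(2)] ms u u_def by auto
  then have "foldr f ks x = foldr f (j # ms) x" "foldr f ls x = foldr f (i # ms) x"
    using IH I(3) J(3) coxeter_length_simple_comp(1)[OF w] I(1,2) J(1,2) by (metis lessI)+
  then show ?thesis using comm by (simp add: fun_eq_iff)
qed

text \<open>
  The same argument with \<open>w = s\<^sub>i s\<^sub>j s\<^sub>i u = s\<^sub>j s\<^sub>i s\<^sub>j u\<close> for \<open>j = i + 1\<close>: the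
  values \<open>i\<close>, \<open>i + 1\<close>, \<open>i + 2\<close> occur in \<open>w\<close> in decreasing order, so that all
  three simple transpositions can be split off.
\<close>

lemma foldr_reduced_word_braid:
  fixes f :: "nat \<Rightarrow> 'a \<Rightarrow> 'a"
  assumes braid: "f i \<circ> f (Suc i) \<circ> f i = f (Suc i) \<circ> f i \<circ> f (Suc i)"
    and red: "reduced_word n w (i # ks)" "reduced_word n w (Suc i # ls)"
    and IH: "\<And>v ks' ls'. coxeter_length n v < coxeter_length n w \<Longrightarrow>
      reduced_word n v ks' \<Longrightarrow> reduced_word n v ls' \<Longrightarrow> foldr f ks' x = foldr f ls' x"
  shows "foldr f (i # ks) x = foldr f (Suc i # ls) x"
proof -
  let ?j = "Suc i"
  have w: "w permutes {1..n}" by (rule reduced_word_permutes[OF red(1)])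
  note I = reduced_word_ConsD[OF red(1)] and J = reduced_word_ConsD[OF red(2)]
  have wi: "simple i \<circ> w permutes {1..n}" and wj: "simple ?j \<circ> w permutes {1..n}"
    using permutes_simple_comp[OF w] I(1) J(1) by blast+
  have wji: "simple ?j \<circ> (simple i \<circ> w) permutes {1..n}"
    and wij: "simple i \<circ> (simple ?j \<circ> w) permutes {1..n}"
    using permutes_simple_comp[OF wi J(1)] permutes_simple_comp[OF wj I(1)] .
  have asc: "perm_inv w (Suc i) < perm_inv w i" "perm_inv w (Suc (Suc i)) < perm_inv w (Suc i)"
    using I(2) J(2) by (auto simp: left_descent_def)
  have D: "left_descent (simple i \<circ> w) ?j" "left_descent (simple ?j \<circ> w) i"
    "left_descent (simple ?j \<circ> (simple i \<circ> w)) i" "left_descent (simple i \<circ> (simple ?j \<circ> w)) ?j"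
    using asc
    unfolding left_descent_def inv_simple_comp[OF wi] inv_simple_comp[OF wj] inv_simple_comp[OF w]
    by (auto simp: simple_def transpose_def)
  define u where "u = simple i \<circ> (simple ?j \<circ> (simple i \<circ> w))"
  have u: "u = simple ?j \<circ> (simple i \<circ> (simple ?j \<circ> w))"
    unfolding u_def by (rule simple_braid)
  have "u permutes {1..n}" unfolding u_def by (rule permutes_simple_comp[OF wji I(1)])
  then obtain ms where ms: "reduced_word n u ms" using exists_reduced_word by blast
  have "reduced_word n (simple i \<circ> w) (?j # i # ms)"
    using ms unfolding u_def
    by (intro reduced_word_ConsI wi wji I(1) J(1) D) simp_all
  moreover have "reduced_word n (simple ?j \<circ> w) (i # ?j # ms)"
    using ms unfolding u
    by (intro reduced_word_ConsI wj wij I(1) J(1) D) simp_all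
  ultimately have "foldr f ks x = foldr f (?j # i # ms) x" "foldr f ls x = foldr f (i # ?j # ms) x"
    using IH I(3) J(3) coxeter_length_simple_comp(1)[OF w] I(1,2) J(1,2) by (metis lessI)+
  then show ?thesis using braid by (simp add: fun_eq_iff)
qed

text \<open>
  Matsumoto's theorem for the symmetric group, by induction on the length. Words with the same first
  letter are compared behind it; if the first letters differ, they are adjacent or commute, and the
  two preceding lemmas apply.
\<close>

lemma foldr_reduced_word_eq:
  fixes f :: "nat \<Rightarrow> 'a \<Rightarrow> 'a"
  assumes comm: "\<And>i j. i \<in> {1..<n} \<Longrightarrow> j \<in> {1..<n} \<Longrightarrow> i + 1 < j \<or> j + 1 < i \<Longrightarrow> f i \<circ> f j = f j \<circ> f i"
    and braid: "\<And>i. i \<in> {1..<n} \<Longrightarrow> Suc i \<in> {1..<n} \<Longrightarrow>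
      f i \<circ> f (Suc i) \<circ> f i = f (Suc i) \<circ> f i \<circ> f (Suc i)"
    and red: "reduced_word n w ks" "reduced_word n w ls"
  shows "foldr f ks x = foldr f ls x"
  using red
proof (induction "coxeter_length n w" arbitrary: w ks ls rule: less_induct)
  case less
  note IH = less.hyps
  have len: "length ks = length ls" using less.prems by (simp add: reduced_word_def)
  show ?case
  proof (cases ks)
    case Nil
    then show ?thesis using len by simp
  next
    case (Cons i ks')
    then obtain j ls' where ls: "ls = j # ls'" using len by (cases ls) auto
    note redI = less.prems(1)[unfolded Cons] and redJ = less.prems(2)[unfolded ls]
    note I = reduced_word_ConsD[OF redI] and J = reduced_word_ConsD[OF redJ]
    consider "i = j" | "i + 1 < j \<or> j + 1 < i" | "j = Suc i" | "i = Suc j" by linarith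
    then show ?thesis
    proof cases
      case 1
      have "coxeter_length n (simple i \<circ> w) < coxeter_length n w"
        using coxeter_length_simple_comp(1)[OF reduced_word_permutes[OF redI] I(1,2)] by simp
      from IH[OF this I(3)] J(3) 1 show ?thesis by (simp add: Cons ls)
    next
      case 2
      show ?thesis unfolding Cons ls
        by (rule foldr_reduced_word_commute[OF comm[OF I(1) J(1) 2] 2 redI redJ IH])
    next
      case 3
      show ?thesis unfolding Cons ls 3
        using redI redJ braid I(1) J(1) IH unfolding 3 by (intro foldr_reduced_word_braid) blast+
    next
      case 4
      show ?thesis unfolding Cons ls 4
        using redI redJ braid I(1) J(1) IH unfolding 4
        by (intro foldr_reduced_word_braid[symmetric]) blast+
    qed
  qed
qed

section \<open>Bruhat order and subwords of reduced words\<close>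

lemma coxeter_length_less_transpose_iff:
  assumes u: "u permutes {1..n}" and ab: "a \<in> {1..n}" "b \<in> {1..n}" "a < b"
  shows "coxeter_length n u < coxeter_length n (transpose a b \<circ> u) \<longleftrightarrow> perm_inv u a < perm_inv u b"
proof
  have tu: "transpose a b \<circ> u permutes {1..n}" by (rule permutes_transpose_comp[OF u ab(1,2)])
  note len = coxeter_length_eq_inversions[OF u] coxeter_length_eq_inversions[OF tu]
  show "coxeter_length n u < coxeter_length n (transpose a b \<circ> u)" if "perm_inv u a < perm_inv u b"
    unfolding len by (rule card_inversions_transpose[OF u ab that])
  show "perm_inv u a < perm_inv u b" if less: "coxeter_length n u < coxeter_length n (transpose a b \<circ> u)"
  proof (rule ccontr)
    assume "\<not> perm_inv u a < perm_inv u b"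
    moreover have "perm_inv u a \<noteq> perm_inv u b"
      using permutes_inverses(1)[OF u] ab(3) by (metis less_irrefl)
    ultimately have "perm_inv (transpose a b \<circ> u) a < perm_inv (transpose a b \<circ> u) b"
      by (simp add: inv_transpose_comp[OF u])
    from card_inversions_transpose[OF tu ab this] less show False
      unfolding len by (simp add: o_assoc)
  qed
qed

lemma bruhat_stepE:
  assumes "bruhat_step n u w"
  obtains a b where "a \<in> {1..n}" "b \<in> {1..n}" "a < b" "w = transpose a b \<circ> u"
    "coxeter_length n u < coxeter_length n w"
  using assms unfolding bruhat_step_def by (metis linorder_neqE_nat transpose_commute)

text \<open>
  If \<open>w = t u\<close> with \<open>t = transpose a b\<close> different from \<open>s\<^sub>i\<close>, then
  \<open>s\<^sub>i w = (s\<^sub>i t s\<^sub>i) (s\<^sub>i u)\<close>, where \<open>s\<^sub>i t s\<^sub>i\<close> exchanges the numbers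
  \<open>s\<^sub>i a < s\<^sub>i b\<close>. Their positions in \<open>s\<^sub>i u\<close> are those of \<open>a\<close> and \<open>b\<close> in
  \<open>u\<close>, so that this multiplication increases the length as well.
\<close>

lemma bruhat_step_simple:
  assumes step: "bruhat_step n u w" and u: "u permutes {1..n}" and i: "i \<in> {1..<n}"
  shows "simple i \<circ> u = w \<or> bruhat_step n (simple i \<circ> u) (simple i \<circ> w)"
proof -
  from step obtain a b where ab: "a \<in> {1..n}" "b \<in> {1..n}" "a < b" and w: "w = transpose a b \<circ> u"
    and less: "coxeter_length n u < coxeter_length n w" by (rule bruhat_stepE)
  show ?thesis
  proof (cases "a = i \<and> b = Suc i")
    case True
    then show ?thesis by (simp add: w simple_def)
  next
    case False
    let ?a = "simple i a" and ?b = "simple i b"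
    have lt: "?a < ?b" using simple_mono[OF ab(3)] False by blast
    have range: "?a \<in> {1..n}" "?b \<in> {1..n}"
      using ab i by (auto simp: simple_def transpose_def)
    have "inj (simple i)" by (simp add: simple_def)
    then have conj: "simple i \<circ> w = transpose ?a ?b \<circ> (simple i \<circ> u)"
      by (auto simp: w fun_eq_iff transpose_def dest: injD)
    have "perm_inv u a < perm_inv u b"
      using coxeter_length_less_transpose_iff[OF u ab] less w by simp
    then have "perm_inv (simple i \<circ> u) ?a < perm_inv (simple i \<circ> u) ?b"
      by (simp add: inv_simple_comp[OF u])
    then have "coxeter_length n (simple i \<circ> u) < coxeter_length n (simple i \<circ> w)"
      unfolding conj using coxeter_length_less_transpose_iff[OF permutes_simple_comp[OF u i] range lt]
      by simp
    then show ?thesis unfolding bruhat_step_def using range lt conj by (metis less_irrefl)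
  qed
qed

lemma bruhat_step_permutes:
  assumes "bruhat_step n u w" "u permutes {1..n}"
  shows "w permutes {1..n}"
  using assms by (metis bruhat_stepE permutes_transpose_comp)

lemma bruhat_step_left_ascent:
  assumes w: "w permutes {1..n}" and i: "i \<in> {1..<n}" and asc: "\<not> left_descent w i"
  shows "bruhat_step n w (simple i \<circ> w)"
proof -
  have "i \<in> {1..n}" "Suc i \<in> {1..n}" "i \<noteq> Suc i" using i by auto
  then show ?thesis
    using coxeter_length_simple_comp(2)[OF w i asc] unfolding bruhat_step_def simple_def
    by (metis lessI)
qed

text \<open>
  The lifting property of the Bruhat order. Multiplication by \<open>s\<^sub>i\<close> carries a chain from
  \<open>u\<close> to \<open>w\<close> to a chain from \<open>s\<^sub>i u\<close> to \<open>s\<^sub>i w\<close>, unless it takes the lower end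
  of a step to its upper end. In that case the rest of the original chain leads to \<open>w\<close>, and the
  ascent from \<open>w\<close> to \<open>s\<^sub>i w\<close> completes it.
\<close>

lemma bruhat_le_left_ascent:
  assumes le: "bruhat_le n u w" and u: "u permutes {1..n}" and w: "w permutes {1..n}"
    and i: "i \<in> {1..<n}" and asc: "\<not> left_descent w i"
  shows "bruhat_le n (simple i \<circ> u) (simple i \<circ> w)"
  using le[unfolded bruhat_le_def] u
proof (induction rule: converse_rtranclp_induct)
  case base
  show ?case by (simp add: bruhat_le_def)
next
  case (step u u')
  note up = \<open>bruhat_step n u u'\<close>
  from bruhat_step_simple[OF up step.prems i] show ?case
  proof
    assume "simple i \<circ> u = u'"
    then show ?thesis
      using step.hyps(2) bruhat_step_left_ascent[OF w i asc] unfolding bruhat_le_def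
      by (metis rtranclp.rtrancl_into_rtrancl)
  next
    assume "bruhat_step n (simple i \<circ> u) (simple i \<circ> u')"
    then show ?thesis
      using step.IH[OF bruhat_step_permutes[OF up step.prems]] unfolding bruhat_le_def
      by (metis converse_rtranclp_into_rtranclp)
  qed
qed

section \<open>Tableaux and permutations\<close>

lemma column_reading_less:
  assumes "finite (boxes lam)" "b \<in> boxes lam" "b' \<in> boxes lam"
    and le: "column_reading_le b b'" "b \<noteq> b'"
  shows "column_reading lam b < column_reading lam b'"
proof -
  have trans: "column_reading_le x b'" if "column_reading_le x b" for x
    using that le(1) by (cases x; cases b; cases b') auto
  have "\<not> column_reading_le b' b" "column_reading_le b' b'"
    using le by (cases b; cases b'; auto)+
  then have "{x \<in> boxes lam. column_reading_le x b} \<subset> {x \<in> boxes lam. column_reading_le x b'}"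
    using trans assms(3) by blast
  then show ?thesis using assms by (simp add: column_reading_def psubset_card_mono)
qed

lemma column_reading_le_total: "column_reading_le b b' \<or> column_reading_le b' b"
  by (cases b; cases b') auto

lemma is_tableau_boxes:
  assumes "is_tableau n lam T"
  shows "finite (boxes lam)" "card (boxes lam) = n"
  using assms bij_betw_finite bij_betw_same_card unfolding is_tableau_def by fastforce+

lemma column_reading_row_less:
  assumes "finite (boxes lam)" "(k, x, y) \<in> boxes lam" "(k, x, y') \<in> boxes lam" "y < y'"
  shows "column_reading lam (k, x, y) < column_reading lam (k, x, y')"
  using assms by (intro column_reading_less) auto

lemma column_reading_column_less:
  assumes "finite (boxes lam)" "(k, x, y) \<in> boxes lam" "(k, x', y) \<in> boxes lam" "x < x'"
  shows "column_reading lam (k, x, y) < column_reading lam (k, x', y)"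
  using assms by (intro column_reading_less) auto

text \<open>
  The reading order is a linear order of the boxes that increases along rows and down columns, and the
  entry of a box is its rank in this order.
\<close>

lemma column_reading_in_SYT:
  assumes fin: "finite (boxes lam)" and card: "card (boxes lam) = n"
  shows "column_reading lam \<in> SYT n lam"
proof -
  let ?C = "column_reading lam"
  have inj: "inj_on ?C (boxes lam)"
    by (rule inj_onI) (metis column_reading_le_total column_reading_less fin less_irrefl)
  have "?C b \<in> {1..n}" if b: "b \<in> boxes lam" for b
  proof -
    have "b \<in> {b' \<in> boxes lam. column_reading_le b' b}"
      using b by (cases b) auto
    then have "0 < card {b' \<in> boxes lam. column_reading_le b' b}"
      unfolding card_gt_0_iff using fin by (intro conjI) (blast, simp)
    then have "0 < ?C b" using b by (simp add: column_reading_def)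
    moreover have "?C b \<le> n"
      using b fin card by (auto simp: column_reading_def intro: card_mono)
    ultimately show ?thesis by simp
  qed
  then have sub: "?C ` boxes lam \<subseteq> {1..n}" by blast
  moreover have "card (?C ` boxes lam) = card {1..n}" using card card_image[OF inj] by simp
  ultimately have "bij_betw ?C (boxes lam) {1..n}"
    unfolding bij_betw_def using inj card_subset_eq[OF _ sub] by simp
  then have "is_tableau n lam ?C" by (simp add: is_tableau_def column_reading_def)
  then show ?thesis
    using column_reading_row_less[OF fin] column_reading_column_less[OF fin]
    unfolding SYT_def standard_def by blast
qed

lemma is_tableau_permute:
  assumes "w permutes {1..n}" "is_tableau n lam T"
  shows "is_tableau n lam (w \<circ> T)"
proof -
  have "w 0 = 0" using assms(1) by (simp add: permutes_not_in)
  moreover have "bij_betw (w \<circ> T) (boxes lam) {1..n}"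
    using assms(2) by (intro bij_betw_trans[OF _ permutes_imp_bij[OF assms(1)]]) (simp add: is_tableau_def)
  ultimately show ?thesis using assms(2) by (simp add: is_tableau_def)
qed

lemma permute_tableau_inj:
  assumes C: "is_tableau n lam C" and "u permutes {1..n}" "w permutes {1..n}" "u \<circ> C = w \<circ> C"
  shows "u = w"
proof
  fix x
  show "u x = w x"
  proof (cases "x \<in> {1..n}")
    case True
    then obtain b where "x = C b" using C unfolding is_tableau_def bij_betw_def by blast
    then show ?thesis using fun_cong[OF assms(4), of b] by simp
  next
    case False
    then show ?thesis using assms(2,3) by (simp add: permutes_not_in)
  qed
qed

lemma exists_permutation_of_tableau:
  assumes C: "is_tableau n lam C" and T: "is_tableau n lam T"
  shows "\<exists>w. w permutes {1..n} \<and> w \<circ> C = T"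
proof -
  define w where "w x = (if x \<in> {1..n} then T (inv_into (boxes lam) C x) else x)" for x
  have bC: "bij_betw C (boxes lam) {1..n}" and bT: "bij_betw T (boxes lam) {1..n}"
    using C T by (auto simp: is_tableau_def)
  have "bij_betw (T \<circ> inv_into (boxes lam) C) {1..n} {1..n}"
    by (rule bij_betw_trans[OF bij_betw_inv_into[OF bC] bT])
  then have "bij_betw w {1..n} {1..n}"
    by (rule bij_betw_cong[THEN iffD1, rotated]) (simp add: w_def)
  then have "w permutes {1..n}" by (rule bij_imp_permutes) (auto simp: w_def)
  moreover have "w (C b) = T b" for b
  proof (cases "b \<in> boxes lam")
    case True
    then show ?thesis using bC by (auto simp: w_def bij_betw_def)
  next
    case False
    then have "C b = 0" "T b = 0" using C T unfolding is_tableau_def by blast+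
    then show ?thesis by (simp add: w_def)
  qed
  ultimately show ?thesis by (auto simp: fun_eq_iff)
qed

lemma tableau_perm_eqI:
  assumes "is_tableau n lam (column_reading lam)" "w permutes {1..n}" "w \<circ> column_reading lam = T"
  shows "tableau_perm n lam T = w"
  unfolding tableau_perm_def
  using assms permute_tableau_inj[OF assms(1)] by (intro the_equality) blast+

text \<open>
  Exchanging \<open>i\<close> and \<open>i + 1\<close> in a standard tableau can only fail to be standard if
  \<open>i\<close> and \<open>i + 1\<close> stand in this order in a row or a column. Then the column reading meets
  \<open>i\<close> before \<open>i + 1\<close>, that is, \<open>i\<close> is no left descent of the permutation. Hence every
  word obtained by splitting off left descents stays within the standard tableaux.
\<close>

lemma simple_left_descent_SYT:
  assumes w: "w permutes {1..n}" and i: "i \<in> {1..<n}" and desc: "left_descent w i"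
    and T: "w \<circ> column_reading lam \<in> SYT n lam"
  shows "simple i \<circ> (w \<circ> column_reading lam) \<in> SYT n lam"
proof -
  let ?C = "column_reading lam" and ?T = "w \<circ> column_reading lam"
  have tab: "is_tableau n lam ?T" and std: "standard lam ?T" using T by (auto simp: SYT_def)
  note fin = is_tableau_boxes(1)[OF tab]
  have simple_perm: "simple i permutes {1..n}"
    using i unfolding simple_def by (intro permutes_swap_id) auto
  have swap: "simple i (?T b) < simple i (?T b')" if "?T b < ?T b'" "?C b < ?C b'" for b b'
  proof (rule simple_mono[OF that(1)])
    show "\<not> (?T b = i \<and> ?T b' = Suc i)"
    proof
      assume eq: "?T b = i \<and> ?T b' = Suc i"
      have "perm_inv w (w z) = z" for z using permutes_inverses(2)[OF w] .
      with eq have "perm_inv w i = ?C b" "perm_inv w (Suc i) = ?C b'" by (metis comp_apply)+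
      with desc that(2) show False by (simp add: left_descent_def)
    qed
  qed
  have "standard lam (simple i \<circ> ?T)"
    using std swap column_reading_row_less[OF fin] column_reading_column_less[OF fin]
    unfolding standard_def by (metis comp_apply)
  then show ?thesis using is_tableau_permute[OF simple_perm tab] by (simp add: SYT_def)
qed

section \<open>Paths and subpaths\<close>

lemma is_path_snoc:
  assumes path: "is_path n lam S T (ks, Ts)" and edge: "weak_bruhat_edge n lam T i T'"
  shows "is_path n lam S T' (ks @ [i], Ts @ [T'])"
proof -
  have len: "length Ts = Suc (length ks)" and lst: "last Ts = T"
    and steps: "\<And>j. j < length ks \<Longrightarrow> weak_bruhat_edge n lam (Ts ! j) (ks ! j) (Ts ! Suc j)"
    using path by (auto simp: is_path_def)
  have ne: "Ts \<noteq> []" using len by auto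
  then have "Ts ! length ks = T" using len lst by (simp add: last_conv_nth)
  then have "weak_bruhat_edge n lam ((Ts @ [T']) ! j) ((ks @ [i]) ! j) ((Ts @ [T']) ! Suc j)"
    if "j < Suc (length ks)" for j
    using that steps[of j] len edge by (cases "j = length ks") (auto simp: nth_append)
  moreover have "T' \<in> SYT n lam" using edge unfolding weak_bruhat_edge_def by blast
  ultimately show ?thesis
    using path ne by (simp add: is_path_def)
qed

text \<open>
  Every reduced word of a permutation that takes the column reading tableau to a standard tableau is
  spelled by a path. The word is reversed since the last step of the path is the leftmost factor.
\<close>

lemma reduced_word_path:
  assumes "column_reading lam \<in> SYT n lam" "reduced_word n w ks" "w \<circ> column_reading lam \<in> SYT n lam"
  shows "\<exists>Ts. is_path n lam (column_reading lam) (w \<circ> column_reading lam) (rev ks, Ts)"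
  using assms(2,3)
proof (induction ks arbitrary: w)
  case Nil
  then have "w = id" by (simp add: reduced_word_def)
  then show ?case using assms(1) by (intro exI[of _ "[column_reading lam]"]) (simp add: is_path_def)
next
  case (Cons i ks)
  let ?C = "column_reading lam"
  note D = reduced_word_ConsD[OF Cons.prems(1)]
  have w: "w permutes {1..n}" by (rule reduced_word_permutes[OF Cons.prems(1)])
  have S: "simple i \<circ> (w \<circ> ?C) \<in> SYT n lam"
    by (rule simple_left_descent_SYT[OF w D(1,2) Cons.prems(2)])
  then obtain Ts where "is_path n lam ?C (simple i \<circ> (w \<circ> ?C)) (rev ks, Ts)"
    using Cons.IH[OF D(3)] unfolding comp_assoc by blast
  moreover have "weak_bruhat_edge n lam (simple i \<circ> (w \<circ> ?C)) i (w \<circ> ?C)"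
    unfolding weak_bruhat_edge_def using S Cons.prems(2) D(1) by (metis simple_comp_simple)
  ultimately have "is_path n lam ?C (w \<circ> ?C) (rev ks @ [i], Ts @ [w \<circ> ?C])"
    by (rule is_path_snoc)
  then show ?case by (metis rev.simps(2))
qed

text \<open>
  The subpaths of a path depend on its first vertex and its labels only. Dropping the other vertices
  allows an induction on the word of labels.
\<close>

definition subpaths :: "nat \<Rightarrow> nat list list \<Rightarrow> tableau \<Rightarrow> nat list \<Rightarrow> subpath set" where
  "subpaths n lam S ks = {(zs, Ss).
     length zs = length ks \<and> length Ss = Suc (length ks) \<and> set Ss \<subseteq> SYT n lam \<and> hd Ss = S \<and>
     (\<forall>j<length ks. zs ! j \<in> {simple (ks ! j), id} \<and> Ss ! Suc j = zs ! j \<circ> Ss ! j)}"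

lemma subpaths_to_eq:
  "subpaths_to n lam (ks, Ts) R = {\<omega> \<in> subpaths n lam (hd Ts) ks. last (snd \<omega>) = R}"
  by (auto simp: subpaths_to_def subpaths_def is_subpath_def)

lemma subpaths_last_in_SYT:
  assumes "\<omega> \<in> subpaths n lam S ks"
  shows "last (snd \<omega>) \<in> SYT n lam"
proof -
  obtain zs Ss where \<omega>: "\<omega> = (zs, Ss)" by fastforce
  then have "length Ss = Suc (length ks)" "set Ss \<subseteq> SYT n lam"
    using assms by (auto simp: subpaths_def)
  then show ?thesis using \<omega> by (cases Ss rule: rev_cases) auto
qed

lemma snoc_in_subpaths_iff:
  "(zs @ [z], Ss @ [R]) \<in> subpaths n lam S (ks @ [i]) \<longleftrightarrow>
    (zs, Ss) \<in> subpaths n lam S ks \<and> z \<in> {simple i, id} \<and> R = z \<circ> last Ss \<and> R \<in> SYT n lam"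
proof (cases "length zs = length ks \<and> length Ss = Suc (length ks)")
  case True
  then have ne: "Ss \<noteq> []" by auto
  then have "last Ss = Ss ! length ks" using True by (simp add: last_conv_nth)
  with ne show ?thesis
    using True by (auto simp: subpaths_def All_less_Suc nth_append hd_append)
next
  case False
  then show ?thesis by (auto simp: subpaths_def)
qed

lemma subpaths_Nil:
  assumes "S \<in> SYT n lam"
  shows "subpaths n lam S [] = {([], [S])}"
  using assms by (auto simp: subpaths_def length_Suc_conv)

text \<open>
  A subpath of a path prolonged by \<open>s\<^sub>i\<close> either stays where it is, or moves along \<open>s\<^sub>i\<close>
  provided that it arrives at a standard tableau.
\<close>

lemma subpaths_snoc:
  "subpaths n lam S (ks @ [i]) =
     (\<lambda>\<omega>. (fst \<omega> @ [id], snd \<omega> @ [last (snd \<omega>)])) ` subpaths n lam S ks \<union>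
     (\<lambda>\<omega>. (fst \<omega> @ [simple i], snd \<omega> @ [simple i \<circ> last (snd \<omega>)])) `
       {\<omega> \<in> subpaths n lam S ks. simple i \<circ> last (snd \<omega>) \<in> SYT n lam}"
  (is "_ = ?stay ` _ \<union> ?move ` _")
proof (intro equalityI subsetI)
  fix \<omega> assume \<omega>: "\<omega> \<in> subpaths n lam S (ks @ [i])"
  then have "length (fst \<omega>) = Suc (length ks)" "length (snd \<omega>) = Suc (Suc (length ks))"
    by (auto simp: subpaths_def)
  then obtain zs z Ss R where eq: "\<omega> = (zs @ [z], Ss @ [R])"
    by (metis length_0_conv nat.distinct(1) prod.collapse rev_exhaust)
  from \<omega>[unfolded eq snoc_in_subpaths_iff]
  have mem: "(zs, Ss) \<in> subpaths n lam S ks" and R: "R = z \<circ> last Ss" "R \<in> SYT n lam"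
    and z: "z = simple i \<or> z = id" by auto
  from z show "\<omega> \<in> ?stay ` subpaths n lam S ks \<union>
    ?move ` {\<omega> \<in> subpaths n lam S ks. simple i \<circ> last (snd \<omega>) \<in> SYT n lam}"
  proof
    assume "z = simple i"
    then show ?thesis using eq mem R by (intro UnI2 image_eqI[of _ _ "(zs, Ss)"]) auto
  next
    assume "z = id"
    then show ?thesis using eq mem R by (intro UnI1 image_eqI[of _ _ "(zs, Ss)"]) auto
  qed
next
  fix \<omega> assume "\<omega> \<in> ?stay ` subpaths n lam S ks \<union>
    ?move ` {\<omega> \<in> subpaths n lam S ks. simple i \<circ> last (snd \<omega>) \<in> SYT n lam}"
  then show "\<omega> \<in> subpaths n lam S (ks @ [i])"
    using subpaths_last_in_SYT by (fastforce simp: snoc_in_subpaths_iff)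
qed

lemma finite_subpaths: "S \<in> SYT n lam \<Longrightarrow> finite (subpaths n lam S ks)"
  by (induction ks rule: rev_induct) (simp_all add: subpaths_Nil subpaths_snoc)

lemma simple_neq_id: "simple i \<noteq> id"
  by (simp add: simple_def transpose_eq_id_iff)

lemma subpath_weight_snoc:
  assumes "\<omega> \<in> subpaths n lam S ks"
  shows "subpath_weight lam us q (ks @ [i], Ts) (fst \<omega> @ [z], snd \<omega> @ [R]) =
    subpath_weight lam us q (ks, Ts') \<omega> *
      (if z = id then a_coeff lam us q i (last (snd \<omega>)) else a_coeff lam us q i (last (snd \<omega>)) + inverse q)"
proof -
  obtain zs Ss where \<omega>: "\<omega> = (zs, Ss)" by fastforce
  have len: "length zs = length ks" "length Ss = Suc (length ks)"
    using assms \<omega> by (auto simp: subpaths_def)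
  then have "Ss \<noteq> []" by auto
  then have "last Ss = Ss ! length ks" using len by (simp add: last_conv_nth)
  define step where "step zs Ss ks j =
    (if zs ! j = id then a_coeff lam us q (ks ! j) (Ss ! j) else a_coeff lam us q (ks ! j) (Ss ! j) + inverse q)"
    for zs :: "(nat \<Rightarrow> nat) list" and Ss ks j
  have "step (zs @ [z]) (Ss @ [R]) (ks @ [i]) j = step zs Ss ks j" if "j < length ks" for j
    using that len by (simp add: step_def nth_append)
  then have "(\<Prod>j<length ks. step (zs @ [z]) (Ss @ [R]) (ks @ [i]) j) = (\<Prod>j<length ks. step zs Ss ks j)"
    by (intro prod.cong) auto
  moreover have "step (zs @ [z]) (Ss @ [R]) (ks @ [i]) (length ks) =
      (if z = id then a_coeff lam us q i (last Ss) else a_coeff lam us q i (last Ss) + inverse q)"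
    using len \<open>last Ss = Ss ! length ks\<close> by (simp add: step_def nth_append)
  ultimately show ?thesis
    by (simp add: \<omega> subpath_weight_def step_def[symmetric] lessThan_Suc mult.commute)
qed

text \<open>
  The permutation at the end of a subpath is a product over a subword of a reduced word of \<open>w\<close>.
  When the factor \<open>s\<^sub>i\<close> is put in front of the word, \<open>w\<close> makes an ascent, and the lifting
  property keeps \<open>s\<^sub>i u\<close> below \<open>s\<^sub>i w\<close>, while \<open>u\<close> stays below \<open>s\<^sub>i w\<close> by
  transitivity.
\<close>

lemma subpath_bruhat_le:
  assumes "reduced_word n w (rev ks)" "\<omega> \<in> subpaths n lam C ks" "C \<in> SYT n lam"
  shows "\<exists>u. u permutes {1..n} \<and> last (snd \<omega>) = u \<circ> C \<and> bruhat_le n u w"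
  using assms(1,2)
proof (induction ks arbitrary: w \<omega> rule: rev_induct)
  case Nil
  then have "w = id" "last (snd \<omega>) = C" using assms(3) by (auto simp: reduced_word_def subpaths_Nil)
  then show ?case unfolding bruhat_le_def by (metis id_comp permutes_id rtranclp.rtrancl_refl)
next
  case (snoc i ks)
  have red: "reduced_word n w (i # rev ks)" using snoc.prems(1) by simp
  note D = reduced_word_ConsD[OF red]
  have w: "w permutes {1..n}" by (rule reduced_word_permutes[OF red])
  let ?w = "simple i \<circ> w"
  have w': "?w permutes {1..n}" by (rule permutes_simple_comp[OF w D(1)])
  have asc: "\<not> left_descent ?w i" using D(2) left_descent_simple_comp[OF w] by blast
  from snoc.prems(2) obtain \<omega>' z where \<omega>': "\<omega>' \<in> subpaths n lam C ks"
    and last: "last (snd \<omega>) = z \<circ> last (snd \<omega>')" and z: "z = id \<or> z = simple i"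
    unfolding subpaths_snoc by fastforce
  from snoc.IH[OF D(3) \<omega>'] obtain u where u: "u permutes {1..n}" "last (snd \<omega>') = u \<circ> C"
    and le: "bruhat_le n u ?w" by blast
  from z show ?case
  proof
    assume "z = id"
    moreover have "bruhat_le n u w"
      using le bruhat_step_left_ascent[OF w' D(1) asc] unfolding bruhat_le_def
      by (metis rtranclp.rtrancl_into_rtrancl simple_comp_simple)
    ultimately show ?thesis using u last by auto
  next
    assume "z = simple i"
    moreover have "bruhat_le n (simple i \<circ> u) w"
      using bruhat_le_left_ascent[OF le u(1) w' D(1) asc] by simp
    ultimately show ?thesis
      using u last permutes_simple_comp[OF u(1) D(1)] by (metis comp_assoc)
  qed
qed

text \<open>
  Applying one more operator to a seminormal basis vector gives two terms, and these are the two ways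
  of prolonging a subpath, with the matching factors of the weight. The term of a nonstandard tableau
  vanishes, just as there is no subpath through it.
\<close>

lemma foldr_seminormal_expansion:
  fixes scale :: "complex \<Rightarrow> 'v::ab_group_add \<Rightarrow> 'v"
  assumes vs: "vector_space scale"
    and lin: "\<And>i. i \<in> {1..<n} \<Longrightarrow> Vector_Spaces.linear scale scale (f i)"
    and f: "\<And>i T. i \<in> {1..<n} \<Longrightarrow> T \<in> SYT n lam \<Longrightarrow>
      f i (v T) = scale (a_coeff lam us q i T) (v T) + scale (inverse q + a_coeff lam us q i T)
            (if simple i \<circ> T \<in> SYT n lam then v (simple i \<circ> T) else 0)"
    and S: "S \<in> SYT n lam" and ks: "set ks \<subseteq> {1..<n}"
  shows "foldr f (rev ks) (v S) =
    (\<Sum>\<omega>\<in>subpaths n lam S ks. scale (subpath_weight lam us q (ks, Ts) \<omega>) (v (last (snd \<omega>))))"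
  using ks
proof (induction ks rule: rev_induct)
  case Nil
  interpret vector_space scale by (rule vs)
  show ?case by (simp add: subpaths_Nil[OF S] subpath_weight_def)
next
  case (snoc i ks)
  interpret vector_space scale by (rule vs)
  have i: "i \<in> {1..<n}" and ks: "set ks \<subseteq> {1..<n}" using snoc.prems by auto
  interpret fi: Vector_Spaces.linear scale scale "f i" by (rule lin[OF i])
  let ?P = "subpaths n lam S ks" and ?L = "\<lambda>\<omega> :: subpath. last (snd \<omega>)"
  let ?M = "{\<omega> \<in> ?P. simple i \<circ> ?L \<omega> \<in> SYT n lam}"
  let ?stay = "\<lambda>\<omega>. (fst \<omega> @ [id], snd \<omega> @ [?L \<omega>])"
  let ?move = "\<lambda>\<omega>. (fst \<omega> @ [simple i], snd \<omega> @ [simple i \<circ> ?L \<omega>])"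
  let ?wt = "subpath_weight lam us q (ks, Ts)" and ?a = "\<lambda>\<omega>. a_coeff lam us q i (?L \<omega>)"
  let ?g = "\<lambda>\<omega>. scale (subpath_weight lam us q (ks @ [i], Ts) \<omega>) (v (?L \<omega>))"
  have fin: "finite ?P" by (rule finite_subpaths[OF S])
  have weight: "subpath_weight lam us q (ks @ [i], Ts) (?stay \<omega>) = ?wt \<omega> * ?a \<omega>"
    "subpath_weight lam us q (ks @ [i], Ts) (?move \<omega>) = ?wt \<omega> * (?a \<omega> + inverse q)" if "\<omega> \<in> ?P" for \<omega>
    by (simp_all add: subpath_weight_snoc[OF that, where Ts' = Ts] simple_neq_id)
  have "foldr f (rev (ks @ [i])) (v S) = f i (\<Sum>\<omega>\<in>?P. scale (?wt \<omega>) (v (?L \<omega>)))"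
    using snoc.IH[OF ks] by simp
  also have "\<dots> = (\<Sum>\<omega>\<in>?P. scale (?wt \<omega>) (f i (v (?L \<omega>))))"
    by (simp add: fi.sum fi.scale)
  also have "\<dots> = (\<Sum>\<omega>\<in>?P. scale (?wt \<omega> * ?a \<omega>) (v (?L \<omega>)) +
      (if simple i \<circ> ?L \<omega> \<in> SYT n lam
       then scale (?wt \<omega> * (?a \<omega> + inverse q)) (v (simple i \<circ> ?L \<omega>)) else 0))"
    by (rule sum.cong) (simp_all add: f[OF i subpaths_last_in_SYT] scale_right_distrib add.commute)
  also have "\<dots> = (\<Sum>\<omega>\<in>?P. scale (?wt \<omega> * ?a \<omega>) (v (?L \<omega>))) +
      (\<Sum>\<omega>\<in>?M. scale (?wt \<omega> * (?a \<omega> + inverse q)) (v (simple i \<circ> ?L \<omega>)))"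
    by (simp add: sum.distrib sum.inter_filter[OF fin])
  also have "(\<Sum>\<omega>\<in>?P. scale (?wt \<omega> * ?a \<omega>) (v (?L \<omega>))) = sum ?g (?stay ` ?P)"
    by (subst sum.reindex) (simp_all add: inj_on_def prod_eq_iff weight(1) cong: sum.cong)
  also have "(\<Sum>\<omega>\<in>?M. scale (?wt \<omega> * (?a \<omega> + inverse q)) (v (simple i \<circ> ?L \<omega>))) = sum ?g (?move ` ?M)"
    by (subst sum.reindex) (simp_all add: inj_on_def prod_eq_iff, rule sum.cong, simp_all add: weight(2))
  also have "sum ?g (?stay ` ?P) + sum ?g (?move ` ?M) = sum ?g (subpaths n lam S (ks @ [i]))"
    unfolding subpaths_snoc using fin simple_neq_id
    by (subst sum.union_disjoint) (auto, metis)
  finally show ?case .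
qed

lemma finite_SYT:
  assumes "finite (boxes lam)"
  shows "finite (SYT n lam)"
proof (rule finite_subset)
  show "SYT n lam \<subseteq> {T. \<forall>b. (b \<in> boxes lam \<longrightarrow> T b \<in> {1..n}) \<and> (b \<notin> boxes lam \<longrightarrow> T b = 0)}"
    by (auto simp: SYT_def is_tableau_def bij_betw_def)
  show "finite {T :: tableau. \<forall>b. (b \<in> boxes lam \<longrightarrow> T b \<in> {1..n}) \<and> (b \<notin> boxes lam \<longrightarrow> T b = 0)}"
    by (rule finite_set_of_finite_funs[OF assms]) simp
qed

section \<open>The action of the Hecke algebra\<close>

lemma free_algebra_carrier_iff:
  "f \<in> carrier (free_algebra n) \<longleftrightarrow> (\<forall>w\<in>Poly_Mapping.keys f. set w \<subseteq> {..<n})"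
  by (simp add: free_algebra_def)

lemma free_algebra_closed:
  shows free_zero_closed: "0 \<in> carrier (free_algebra n)"
    and free_one_closed: "1 \<in> carrier (free_algebra n)"
    and free_const_closed: "free_const c \<in> carrier (free_algebra n)"
    and free_gen_closed: "i < n \<Longrightarrow> free_gen i \<in> carrier (free_algebra n)"
    and free_uminus_closed: "f \<in> carrier (free_algebra n) \<Longrightarrow> - f \<in> carrier (free_algebra n)"
    and free_add_closed: "f \<in> carrier (free_algebra n) \<Longrightarrow> g \<in> carrier (free_algebra n) \<Longrightarrow>
      f + g \<in> carrier (free_algebra n)"
    and free_diff_closed: "f \<in> carrier (free_algebra n) \<Longrightarrow> g \<in> carrier (free_algebra n) \<Longrightarrow>
      f - g \<in> carrier (free_algebra n)"
    and free_mult_closed: "f \<in> carrier (free_algebra n) \<Longrightarrow> g \<in> carrier (free_algebra n) \<Longrightarrow>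
      f * g \<in> carrier (free_algebra n)"
proof -
  show "f + g \<in> carrier (free_algebra n)" "f - g \<in> carrier (free_algebra n)"
    if "f \<in> carrier (free_algebra n)" "g \<in> carrier (free_algebra n)" for f g
    using that keys_add[of f g] keys_diff[of f g] unfolding free_algebra_carrier_iff by blast+
  show "f * g \<in> carrier (free_algebra n)"
    if "f \<in> carrier (free_algebra n)" "g \<in> carrier (free_algebra n)" for f g
    using that keys_mult[of f g] unfolding free_algebra_carrier_iff
    by (fastforce simp: plus_list_def)
qed (auto simp: free_algebra_carrier_iff free_const_def free_gen_def zero_list_def)

lemma free_algebra_simps:
  "f \<otimes>\<^bsub>free_algebra n\<^esub> g = f * g" "f \<oplus>\<^bsub>free_algebra n\<^esub> g = f + g"
  "\<one>\<^bsub>free_algebra n\<^esub> = 1" "\<zero>\<^bsub>free_algebra n\<^esub> = 0"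
  by (simp_all add: free_algebra_def)

lemma ring_free_algebra: "ring (free_algebra n)"
proof (intro ringI abelian_groupI monoidI, unfold free_algebra_simps)
  fix f assume "f \<in> carrier (free_algebra n)"
  then show "\<exists>g\<in>carrier (free_algebra n). g + f = 0"
    using free_uminus_closed by (intro bexI[of _ "- f"]) simp_all
qed (simp_all only: free_zero_closed free_one_closed free_add_closed free_mult_closed
    distrib_left distrib_right mult.assoc add.assoc add.commute add.left_commute mult_1_left mult_1_right add_0_left add_0_right)

lemma free_algebra_minus:
  assumes "f \<in> carrier (free_algebra n)" "g \<in> carrier (free_algebra n)"
  shows "f \<ominus>\<^bsub>free_algebra n\<^esub> g = f - g"
proof -
  interpret ring "free_algebra n" by (rule ring_free_algebra)
  have "- g \<oplus>\<^bsub>free_algebra n\<^esub> g = \<zero>\<^bsub>free_algebra n\<^esub>" by (simp add: free_algebra_simps)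
  then have "\<ominus>\<^bsub>free_algebra n\<^esub> g = - g"
    using minus_equality free_uminus_closed assms(2) by blast
  then show ?thesis by (simp add: a_minus_def free_algebra_simps)
qed

lemma hecke_relators_closed: "hecke_relators n us q \<subseteq> carrier (free_algebra n)"
proof -
  have "prod_list (map (\<lambda>u. free_gen 0 - free_const u) us) \<in> carrier (free_algebra n)" if "1 \<le> n"
    using that by (induction us)
      (auto intro!: free_one_closed free_mult_closed free_diff_closed free_gen_closed free_const_closed)
  then show ?thesis
    unfolding hecke_relators_def
    by (auto intro!: free_one_closed free_mult_closed free_add_closed free_diff_closed
        free_gen_closed free_const_closed)
qed

lemma ideal_hecke_ideal: "ideal (hecke_ideal n us q) (free_algebra n)"
  unfolding hecke_ideal_def
  by (rule ring.genideal_ideal[OF ring_free_algebra hecke_relators_closed])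

lemma hecke_class_closed:
  "f \<in> carrier (free_algebra n) \<Longrightarrow> hecke_class n us q f \<in> carrier (hecke_algebra n us q)"
  using ring_hom_closed[OF ideal.rcos_ring_hom[OF ideal_hecke_ideal]]
  unfolding hecke_class_def hecke_algebra_def by blast

lemma hecke_class_mult:
  assumes "f \<in> carrier (free_algebra n)" "g \<in> carrier (free_algebra n)"
  shows "hecke_class n us q (f * g) =
    hecke_class n us q f \<otimes>\<^bsub>hecke_algebra n us q\<^esub> hecke_class n us q g"
  using ring_hom_mult[OF ideal.rcos_ring_hom[OF ideal_hecke_ideal] assms]
  by (simp add: hecke_class_def hecke_algebra_def free_algebra_simps)

lemma hecke_one_eq_const: "\<one>\<^bsub>hecke_algebra n us q\<^esub> = hecke_const n us q 1"
proof -
  have "free_const 1 = \<one>\<^bsub>free_algebra n\<^esub>"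
    by (simp add: free_const_def free_algebra_simps flip: zero_list_def)
  then show ?thesis
    using ring_hom_one[OF ideal.rcos_ring_hom[OF ideal_hecke_ideal[of n us q]]]
    by (simp add: hecke_class_def hecke_const_def hecke_algebra_def)
qed

lemma hecke_class_eqI:
  assumes "f - g \<in> hecke_relators n us q"
    and f: "f \<in> carrier (free_algebra n)" and g: "g \<in> carrier (free_algebra n)"
  shows "hecke_class n us q f = hecke_class n us q g"
proof -
  have "f \<ominus>\<^bsub>free_algebra n\<^esub> g \<in> hecke_ideal n us q"
    unfolding hecke_ideal_def free_algebra_minus[OF f g]
    using ring.genideal_self[OF ring_free_algebra hecke_relators_closed] assms(1) by blast
  then show ?thesis
    using ring.quotient_eq_iff_same_a_r_cos[OF ring_free_algebra ideal_hecke_ideal f g]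
    by (simp add: hecke_class_def)
qed

context hecke_module
begin

lemma act_class_mult:
  assumes "f \<in> carrier (free_algebra n)" "g \<in> carrier (free_algebra n)"
  shows "act (hecke_class n us q (f * g)) x = act (hecke_class n us q f) (act (hecke_class n us q g) x)"
  by (simp add: hecke_class_mult[OF assms] act_mult hecke_class_closed assms)

lemma act_gen_commute:
  assumes "i < n" "j < n" "i + 1 < j \<or> j + 1 < i"
  shows "act (hecke_gen n us q i) \<circ> act (hecke_gen n us q j) =
    act (hecke_gen n us q j) \<circ> act (hecke_gen n us q i)"
proof
  fix x
  have "free_gen i * free_gen j - free_gen j * free_gen i \<in> hecke_relators n us q"
    using assms unfolding hecke_relators_def by blast
  then have "hecke_class n us q (free_gen i * free_gen j) = hecke_class n us q (free_gen j * free_gen i)"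
    using assms by (intro hecke_class_eqI free_mult_closed free_gen_closed)
  then have "act (hecke_class n us q (free_gen i * free_gen j)) x =
    act (hecke_class n us q (free_gen j * free_gen i)) x" by simp
  then show "(act (hecke_gen n us q i) \<circ> act (hecke_gen n us q j)) x =
    (act (hecke_gen n us q j) \<circ> act (hecke_gen n us q i)) x"
    using assms by (simp add: act_class_mult free_gen_closed hecke_gen_def)
qed

lemma act_gen_braid:
  assumes "1 \<le> i" "Suc i < n"
  shows "act (hecke_gen n us q i) \<circ> act (hecke_gen n us q (Suc i)) \<circ> act (hecke_gen n us q i) =
    act (hecke_gen n us q (Suc i)) \<circ> act (hecke_gen n us q i) \<circ> act (hecke_gen n us q (Suc i))"
proof
  fix x
  let ?l = "free_gen i * free_gen (Suc i) * free_gen i"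
    and ?r = "free_gen (Suc i) * free_gen i * free_gen (Suc i)"
  have "?l - ?r \<in> hecke_relators n us q"
    using assms unfolding hecke_relators_def Suc_eq_plus1 by blast
  then have "hecke_class n us q ?l = hecke_class n us q ?r"
    using assms by (intro hecke_class_eqI free_mult_closed free_gen_closed) auto
  then have "act (hecke_class n us q ?l) x = act (hecke_class n us q ?r) x" by simp
  then show "(act (hecke_gen n us q i) \<circ> act (hecke_gen n us q (Suc i)) \<circ> act (hecke_gen n us q i)) x =
    (act (hecke_gen n us q (Suc i)) \<circ> act (hecke_gen n us q i) \<circ> act (hecke_gen n us q (Suc i))) x"
    using assms by (simp add: act_class_mult free_gen_closed free_mult_closed hecke_gen_def)
qed

text \<open>
  That a product acts by the composite of the operators is assumed for elements of the algebra, so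
  membership in the algebra is carried along in the induction.
\<close>

lemma hecke_word_act:
  assumes "set ks \<subseteq> {..<n}"
  shows "hecke_word n us q ks \<in> carrier (hecke_algebra n us q) \<and>
    act (hecke_word n us q ks) x = foldr (\<lambda>i. act (hecke_gen n us q i)) ks x"
  using assms
proof (induction ks)
  case Nil
  have "\<one>\<^bsub>hecke_algebra n us q\<^esub> \<in> carrier (hecke_algebra n us q)"
    by (simp add: hecke_one_eq_const hecke_const_def hecke_class_closed free_const_closed)
  then show ?case using act_const[of 1 x] by (simp add: hecke_word_def hecke_one_eq_const)
next
  case (Cons i ks)
  have gen: "hecke_gen n us q i \<in> carrier (hecke_algebra n us q)"
    using Cons.prems by (simp add: hecke_gen_def hecke_class_closed free_gen_closed)
  have "ring (hecke_algebra n us q)"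
    unfolding hecke_algebra_def by (rule ideal.quotient_is_ring[OF ideal_hecke_ideal])
  then interpret H: ring "hecke_algebra n us q" .
  show ?case
    using Cons gen by (simp add: hecke_word_def act_mult)
qed

text \<open>
  On a module the element \<open>T\<^sub>w\<close> can be evaluated along any reduced word of \<open>w\<close>, although its
  definition picks one: the generators act by operators that satisfy the braid relations.
\<close>

lemma hecke_T_act:
  assumes "reduced_word n w ks"
  shows "act (hecke_T n us q w) x = foldr (\<lambda>i. act (hecke_gen n us q i)) ks x"
proof -
  let ?ls = "SOME ls. reduced_word n w ls"
  have red: "reduced_word n w ?ls" using assms by (rule someI)
  then have "set ?ls \<subseteq> {..<n}" by (auto simp: reduced_word_def)
  then have "act (hecke_T n us q w) x = foldr (\<lambda>i. act (hecke_gen n us q i)) ?ls x"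
    unfolding hecke_T_def using hecke_word_act by blast
  also have "\<dots> = foldr (\<lambda>i. act (hecke_gen n us q i)) ks x"
    using act_gen_commute act_gen_braid
    by (intro foldr_reduced_word_eq[OF _ _ red assms]) auto
  finally show ?thesis .
qed

lemma act_gen_linear:
  assumes "i < n"
  shows "Vector_Spaces.linear scale scale (act (hecke_gen n us q i))"
  unfolding hecke_gen_def using assms by (intro act_linear hecke_class_closed free_gen_closed)

end

section \<open>The expansion of the natural basis\<close>

theorem theorem6p7:
  fixes n r :: nat and lam :: "nat list list"
    and us :: "complex list" and q :: complex
    and scale :: "complex \<Rightarrow> 'v::ab_group_add \<Rightarrow> 'v"
    and act :: "free_elem set \<Rightarrow> 'v \<Rightarrow> 'v"
    and v :: "tableau \<Rightarrow> 'v" and T :: tableau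
  assumes "multipartition r n lam"
    and "length us = r"
    and "admissible_parameters n us q"
    and "hecke_module scale n us q act"
    and "seminormal_basis scale n us q act lam v"
    and "T \<in> SYT n lam"
  shows "(\<exists>\<pi>. reduced_path n lam T \<pi>) \<and>
    (\<forall>\<pi>. reduced_path n lam T \<pi> \<longrightarrow>
       natural_basis n us q act lam v T =
         (\<Sum>S | S \<in> SYT n lam \<and> tableau_le n lam S T. scale (path_coeff n lam us q \<pi> S) (v S)))"
proof -
  interpret hecke_module scale n us q act by fact
  let ?C = "column_reading lam"
  have tabT: "is_tableau n lam T" using assms(6) by (simp add: SYT_def)
  note fin = is_tableau_boxes(1)[OF tabT]
  have C: "?C \<in> SYT n lam" by (rule column_reading_in_SYT[OF is_tableau_boxes[OF tabT]])
  then have tabC: "is_tableau n lam ?C" by (simp add: SYT_def)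
  obtain w where w: "w permutes {1..n}" "w \<circ> ?C = T"
    using exists_permutation_of_tableau[OF tabC tabT] by blast
  have wT: "tableau_perm n lam T = w" by (rule tableau_perm_eqI[OF tabC w])
  show ?thesis
  proof (intro conjI allI impI)
    obtain ks where ks: "reduced_word n w ks" using exists_reduced_word[OF w(1)] by blast
    then obtain Ts where "is_path n lam ?C T (rev ks, Ts)"
      using reduced_word_path[OF C ks] w(2) assms(6) by blast
    then show "\<exists>\<pi>. reduced_path n lam T \<pi>"
      using ks by (intro exI[of _ "(rev ks, Ts)"]) (simp add: reduced_path_def wT)
  next
    fix \<pi> assume \<pi>: "reduced_path n lam T \<pi>"
    obtain ks Ts where eq: "\<pi> = (ks, Ts)" by fastforce
    have red: "reduced_word n w (rev ks)" and hd: "hd Ts = ?C"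
      using \<pi> by (auto simp: eq reduced_path_def is_path_def wT)
    then have range: "set ks \<subseteq> {1..<n}" by (simp add: reduced_word_def)
    let ?B = "{S. S \<in> SYT n lam \<and> tableau_le n lam S T}"
    let ?P = "subpaths n lam ?C ks" and ?end = "\<lambda>\<omega> :: subpath. last (snd \<omega>)"
    \<comment> \<open>The endpoints lie below \<open>T\<close>, so that summation over subpaths grouped by endpoints runs
      over exactly the tableaux of the claim; those that no subpath reaches have coefficient 0.\<close>
    have "?end \<omega> \<in> ?B" if \<omega>: "\<omega> \<in> ?P" for \<omega>
    proof -
      obtain u where u: "u permutes {1..n}" "?end \<omega> = u \<circ> ?C" "bruhat_le n u w"
        using subpath_bruhat_le[OF red \<omega> C] by blast
      have "tableau_perm n lam (?end \<omega>) = u"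
        using tableau_perm_eqI[OF tabC u(1)] u(2) by simp
      then show ?thesis using subpaths_last_in_SYT[OF \<omega>] u(3) by (simp add: tableau_le_def wT)
    qed
    then have ends: "?end ` ?P \<subseteq> ?B" by blast
    have "natural_basis n us q act lam v T = foldr (\<lambda>i. act (hecke_gen n us q i)) (rev ks) (v ?C)"
      unfolding natural_basis_def wT by (rule hecke_T_act[OF red])
    also have "\<dots> = (\<Sum>\<omega>\<in>?P. scale (subpath_weight lam us q \<pi> \<omega>) (v (?end \<omega>)))"
      unfolding eq
    proof (rule foldr_seminormal_expansion[OF vector_space_axioms _ _ C range])
      show "Vector_Spaces.linear scale scale (act (hecke_gen n us q i))" if "i \<in> {1..<n}" for i
        using that by (intro act_gen_linear) simp
    qed (use assms(5) in \<open>simp add: seminormal_basis_def\<close>)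
    also have "\<dots> = (\<Sum>S\<in>?B. \<Sum>\<omega>\<in>{\<omega> \<in> ?P. ?end \<omega> = S}. scale (subpath_weight lam us q \<pi> \<omega>) (v (?end \<omega>)))"
      using finite_SYT[OF fin] by (intro sum.group[symmetric] finite_subpaths C ends) simp
    also have "\<dots> = (\<Sum>S\<in>?B. scale (path_coeff n lam us q \<pi> S) (v S))"
      by (simp add: path_coeff_def eq subpaths_to_eq hd scale_sum_left)
    finally show "natural_basis n us q act lam v T =
      (\<Sum>S | S \<in> SYT n lam \<and> tableau_le n lam S T. scale (path_coeff n lam us q \<pi> S) (v S))" .
  qed
qed

end
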